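(* Let $X$ and $Y$ be separable Hilbert spaces, let $Q$ be the (injective, self-adjoint, positive, trace class) covariance operator of a nondegenerate centered Gaussian measure $\mathcal{N}_Q$ on $Y$, let $y \in Y$, and let $F: X \to Y$ satisfy one of the following two conditions: (A) $\operatorname{ran}(F) \subseteq \operatorname{ran}(Q)$, the map $Q^{-1}\circ F$ is Lipschitz continuous on bounded sets, and there exists $L_0 > 0$ such that $\|Q^{-1}F(u) - Q^{-1}F(0)\|_Y \le L_0\|u\|_X$ for all $u \in X$; or (B) $F$ is a linear operator such that $\operatorname{ran}(F) \subseteq \operatorname{ran}(Q)$ and $Q^{-1}F$ is bounded. Let $\mu_0 = \mathcal{N}_\Sigma$ be a nondegenerate centered Gaussian measure on $X$ with (injective) covariance operator $\Sigma$, and let $\mu^y$ be a Borel probability measure on $X$ which is absolutely continuous with respect to $\mu_0$ with density $\frac{\mathrm{d}\mu^y}{\mathrm{d}\mu_0}(u) = \frac{1}{Z}\exp(-\Phi(u,y))$ for some $Z > 0$, where $$\Phi(u,y) = \frac12\|Q^{-1/2}F(u)\|_Y^2 - (Q^{-1}F(u), y)_Y .$$ Then the (strong) modes of $\mu^y$ are precisely the minimizers of $I: \operatorname{ran}(\Sigma^{1/2}) \to \mathbb{R}$, $$I(u) = \frac12\|Q^{-1/2}F(u)\|_Y^2 - (Q^{-1}F(u),y)_Y + \frac12\|\Sigma^{-1/2}u\|_X^2 .$$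
   Context: $\operatorname{ran}$ denotes the range of a mapping. $B_\varepsilon(x)$ denotes the open ball of radius $\varepsilon$ centred at $x$. A map $G: X \to Y$ is Lipschitz continuous on bounded sets if for every $r > 0$ there exists $L = L(r) > 0$ with $\|G(x_1) - G(x_2)\|_Y \le L\|x_1 - x_2\|_X$ for all $x_1, x_2 \in B_r(0)$. Mode (strong mode): $\hat{x} \in X$ is a mode of a Borel probability measure $\mu$ on $X$ if $\lim_{\varepsilon \to 0} \frac{\mu(B_\varepsilon(\hat{x}))}{\sup_{x \in X}\mu(B_\varepsilon(x))} = 1$. *)

theory Defs
  imports "HOL-Probability.Probability"
begin

(* Separable real Hilbert spaces are types of sort {real_inner, polish_space}: polish_space is
   completeness plus second countability, and the latter is separability for metric spaces. *)

definition positive_operator :: "('a::real_inner \<Rightarrow> 'a) \<Rightarrow> bool" where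
  "positive_operator T \<longleftrightarrow>
     bounded_linear T \<and> (\<forall>x y. inner (T x) y = inner x (T y)) \<and> (\<forall>x. 0 \<le> inner (T x) x)"

definition orthonormal_basis :: "'a::real_inner set \<Rightarrow> bool" where
  "orthonormal_basis E \<longleftrightarrow>
     pairwise orthogonal E \<and> (\<forall>e\<in>E. norm e = 1) \<and> closure (span E) = UNIV"

(* Only meant for positive operators, where the absolute value of T is T itself and the trace
   does not depend on the choice of the basis. *)
definition trace_class :: "('a::real_inner \<Rightarrow> 'a) \<Rightarrow> bool" where
  "trace_class T \<longleftrightarrow> (\<exists>E. orthonormal_basis E \<and> (\<lambda>e. inner (T e) e) summable_on E)"

(* The unique positive square root of a positive operator on a Hilbert space. *)
definition op_sqrt :: "('a::real_inner \<Rightarrow> 'a) \<Rightarrow> 'a \<Rightarrow> 'a" where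
  "op_sqrt T = (THE S. positive_operator S \<and> S \<circ> S = T)"

(* Point masses are the Gaussian measures of variance zero. *)
definition gaussian_real :: "real measure \<Rightarrow> bool" where
  "gaussian_real \<nu> \<longleftrightarrow>
     (\<exists>m. \<nu> = return borel m) \<or> (\<exists>m \<sigma>. \<sigma> > 0 \<and> \<nu> = density lborel (normal_density m \<sigma>))"

definition gaussian_measure :: "'a::real_inner measure \<Rightarrow> bool" where
  "gaussian_measure \<mu> \<longleftrightarrow>
     prob_space \<mu> \<and> sets \<mu> = sets borel \<and> (\<forall>h. gaussian_real (distr \<mu> borel (\<lambda>x. inner x h)))"

definition centered :: "'a::real_inner measure \<Rightarrow> bool" where
  "centered \<mu> \<longleftrightarrow> (\<forall>h. (\<integral>x. inner x h \<partial>\<mu>) = 0)"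

(* Positivity and trace class are built in, as usual for the notation N_C; for a Gaussian measure
   they follow from the integral identity and thus exclude nothing. *)
definition covariance_operator :: "'a::real_inner measure \<Rightarrow> ('a \<Rightarrow> 'a) \<Rightarrow> bool" where
  "covariance_operator \<mu> C \<longleftrightarrow>
     positive_operator C \<and> trace_class C \<and>
     (\<forall>h k. inner (C h) k =
        (\<integral>x. (inner x h - (\<integral>z. inner z h \<partial>\<mu>)) * (inner x k - (\<integral>z. inner z k \<partial>\<mu>)) \<partial>\<mu>))"

(* \<mu> is the centered Gaussian measure N_C, with C injective. *)
definition nondegenerate_centered_gaussian :: "'a::real_inner measure \<Rightarrow> ('a \<Rightarrow> 'a) \<Rightarrow> bool" where
  "nondegenerate_centered_gaussian \<mu> C \<longleftrightarrow>
     gaussian_measure \<mu> \<and> centered \<mu> \<and> covariance_operator \<mu> C \<and> inj C"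

definition lipschitz_on_bounded_sets :: "('a::real_normed_vector \<Rightarrow> 'b::real_normed_vector) \<Rightarrow> bool" where
  "lipschitz_on_bounded_sets G \<longleftrightarrow> (\<forall>r>0. \<exists>L>0. L-lipschitz_on (ball 0 r) G)"

(* Here and below, inv Q and inv (op_sqrt Q) are evaluated only on the ranges of the injective
   maps Q and op_sqrt Q. *)
definition condition_A :: "('b \<Rightarrow> 'b) \<Rightarrow> ('a::real_inner \<Rightarrow> 'b::real_inner) \<Rightarrow> bool" where
  "condition_A Q F \<longleftrightarrow>
     range F \<subseteq> range Q \<and> lipschitz_on_bounded_sets (inv Q \<circ> F) \<and>
     (\<exists>L0>0. \<forall>u. norm (inv Q (F u) - inv Q (F 0)) \<le> L0 * norm u)"

definition condition_B :: "('b \<Rightarrow> 'b) \<Rightarrow> ('a::real_inner \<Rightarrow> 'b::real_inner) \<Rightarrow> bool" where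
  "condition_B Q F \<longleftrightarrow> linear F \<and> range F \<subseteq> range Q \<and> bounded_linear (inv Q \<circ> F)"

definition potential :: "('b \<Rightarrow> 'b) \<Rightarrow> ('a \<Rightarrow> 'b::real_inner) \<Rightarrow> 'a \<Rightarrow> 'b \<Rightarrow> real" where
  "potential Q F u y = 1/2 * (norm (inv (op_sqrt Q) (F u)))\<^sup>2 - inner (inv Q (F u)) y"

definition strong_mode :: "'a::real_normed_vector measure \<Rightarrow> 'a \<Rightarrow> bool" where
  "strong_mode \<mu> x \<longleftrightarrow>
     ((\<lambda>\<epsilon>. measure \<mu> (ball x \<epsilon>) / (SUP z. measure \<mu> (ball z \<epsilon>))) \<longlongrightarrow> 1) (at_right 0)"

(* Only meaningful for u in the range of op_sqrt C. *)
definition functional_I ::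
  "('a \<Rightarrow> 'a) \<Rightarrow> ('b \<Rightarrow> 'b) \<Rightarrow> ('a::real_inner \<Rightarrow> 'b::real_inner) \<Rightarrow> 'b \<Rightarrow> 'a \<Rightarrow> real" where
  "functional_I C Q F y u =
     1/2 * (norm (inv (op_sqrt Q) (F u)))\<^sup>2 - inner (inv Q (F u)) y
       + 1/2 * (norm (inv (op_sqrt C) u))\<^sup>2"

end

(* Let G = Q^-1 F. Then Phi(u) = 1/2 <Q G(u), G(u)> - <G(u), y> is Lipschitz on balls and bounded below by
   -K (1 + |u|), so only small ball probabilities of mu0 have to be understood. Write J_r(z) for the mu0-measure
   of the ball of radius r at z, and S for the square root of C. The Cameron-Martin formula and Anderson's
   inequality J_r(z) <= J_r(0) give, for every w,
     J_r(z) <= exp (1/2 <C w, w> - <w, z> + r |w|) J_r(0),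
   and by convex duality there is v with |S v - z| <= 2 r and J_r(z) <= exp (- 1/2 |v|^2) J_r(0). Conversely,
   symmetry of mu0 yields J_r(S v) >= exp (- 1/2 |v|^2) J_r(0). Together with the local Lipschitz continuity of Phi
   the second bound shows that the supremum over all balls of radius r of the posterior measure is at most
   exp (- inf I + O(r)) J_r(0) / Z, without any weak compactness argument, so minimizers are modes; the first
   bound with r -> 0 and optimal w shows that modes lie in the range of S and minimize I.
   Anderson's inequality for balls is obtained by removing the coordinates of z in an eigenbasis of C one by one. *)
theory Submission
  imports Defs
begin

text \<open>In infinite dimensions no reference measure gives \<mu>0 a density exp (- 1/2 |S^-1
  u|^2), and almost every centre of a ball lies outside the range of S, where I has no value. Hence
  all estimates are relative to the centred ball, and a centre z is replaced by a nearby point S v.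
  The Cameron-Martin density is a continuous function for shifts in the range of C. Thus every shift
  below has the form C w, and the range of S is reached by approximation: truncation in an
  eigenbasis for lower bounds, Tikhonov regularization for upper ones. Cameron-Martin formula and
  reflection invariance are equalities of measures; both come from comparing integrals of exp <x,
  k>, whence the uniqueness theorem at the start. The eigenbasis supplies the directions of the
  reflections and the explicit vectors w; it is constructed from the trace class property by way of
  compactness. The Lipschitz constant of Phi may grow with the radius of the ball. For distant
  centres the linear lower bound on Phi takes over, because 1/2 |v|^2 outgrows it.\<close>

section \<open>Uniqueness of the Laplace transform\<close>

text \<open>Once the lower coefficients vanish, division by x^m leaves a power series with constant
  term \<open>a m\<close>, whose value tends to it as x -> 0.\<close>

lemma powser_coeffs_zero:
  fixes a :: "nat \<Rightarrow> real"
  assumes "\<And>x. (\<lambda>n. a n * x ^ n) sums 0"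
  shows "a n = 0"
proof (induction n rule: less_induct)
  case (less m)
  have "(\<lambda>n. a (n + m) * x ^ n) sums 0" if "x \<noteq> 0" for x
  proof -
    have "(\<lambda>n. a (n + m) * x ^ (n + m)) sums (0 - (\<Sum>i<m. a i * x ^ i))"
      using sums_split_initial_segment[OF assms] .
    then have "(\<lambda>n. x ^ m * (a (n + m) * x ^ n)) sums (x ^ m * 0)"
      using less by (simp add: power_add mult_ac)
    then show ?thesis
      using that by (subst (asm) sums_mult_iff) auto
  qed
  then have "((\<lambda>_. 0) \<longlongrightarrow> a (0 + m)) (at (0::real))"
    using powser_limit_0_strong[of 1 "\<lambda>n. a (n + m)" "\<lambda>_. 0"] by auto
  then show ?case
    by (metis LIM_const_eq add_0)
qed

text \<open>Used at real z, where the Laplace transform determines the moments, and at imaginary z,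
  where the moments return the characteristic function. Sum and integral commute because the partial
  sums of the norms stay below exp (|z| |x|), which is at most exp (|z| x) + exp (- |z| x).\<close>

lemma exp_integral_sums:
  fixes z :: "'a::{real_normed_field,banach,second_countable_topology}"
  assumes [measurable_cong]: "sets M = sets borel"
    and int: "\<And>t::real. integrable M (\<lambda>x. exp (t * x))"
  shows "(\<lambda>n. z ^ n / fact n * of_real (\<integral>x. x ^ n \<partial>M)) sums (\<integral>x. exp (z * of_real x) \<partial>M)"
proof -
  define f where "f = (\<lambda>n x. (z * of_real x) ^ n /\<^sub>R fact n)"
  have nf: "norm (f n x) = (norm z * \<bar>x\<bar>) ^ n /\<^sub>R fact n" for n x
    unfolding f_def by (simp add: norm_power norm_mult)
  have meas [measurable]: "f n \<in> borel_measurable M" for n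
    unfolding f_def by measurable
  have iabs: "integrable M (\<lambda>x. exp (r * \<bar>x\<bar>))" if "r \<ge> 0" for r :: real
  proof (rule Bochner_Integration.integrable_bound)
    show "integrable M (\<lambda>x. exp (r * x) + exp (-r * x))"
      using int[of r] int[of "- r"] by (intro Bochner_Integration.integrable_add) auto
    show "AE x in M. norm (exp (r * \<bar>x\<bar>)) \<le> norm (exp (r * x) + exp (-r * x))"
    proof (intro AE_I2)
      fix x
      have "exp (r * \<bar>x\<bar>) \<le> exp (r * x) + exp (-r * x)"
        by (auto simp: abs_if)
      then show "norm (exp (r * \<bar>x\<bar>)) \<le> norm (exp (r * x) + exp (-r * x))"
        by (simp add: abs_of_pos add_pos_pos)
    qed
  qed simp
  have s: "(\<lambda>n. norm (f n x)) sums exp (norm z * \<bar>x\<bar>)" for x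
    unfolding nf by (rule exp_converges)
  have fbound: "norm (f n x) \<le> exp (norm z * \<bar>x\<bar>)" for n x
    using sum_le_suminf[OF sums_summable[OF s], of "{n}" x] sums_unique[OF s[of x]] by simp
  have fint: "integrable M (f n)" for n
    by (rule Bochner_Integration.integrable_bound[OF iabs[of "norm z"]]) (auto intro: fbound)
  have pint: "integrable M (\<lambda>x. x ^ n)" for n
  proof (rule Bochner_Integration.integrable_bound)
    show "integrable M (\<lambda>x. fact n * exp (1 * \<bar>x\<bar>))"
      using iabs[of 1] by simp
    have "\<bar>x\<bar> ^ n / fact n \<le> exp \<bar>x\<bar>" for x :: real
      using sum_le_suminf[OF sums_summable[OF exp_converges[of "\<bar>x\<bar>"]], of "{n}"]
        sums_unique[OF exp_converges[of "\<bar>x\<bar>"]] by (simp add: divide_inverse mult.commute)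
    then show "AE x in M. norm (x ^ n) \<le> norm (fact n * exp (1 * \<bar>x\<bar>))"
      by (intro AE_I2) (simp add: power_abs field_simps)
  qed simp
  have "summable (\<lambda>n. \<integral>x. norm (f n x) \<partial>M)"
  proof (rule summableI_nonneg_bounded)
    fix n
    have "(\<Sum>i<n. \<integral>x. norm (f i x) \<partial>M) = (\<integral>x. (\<Sum>i<n. norm (f i x)) \<partial>M)"
      using fint by (subst Bochner_Integration.integral_sum) auto
    also have "\<dots> \<le> (\<integral>x. exp (norm z * \<bar>x\<bar>) \<partial>M)"
      using fint iabs[of "norm z"] sum_le_suminf[OF sums_summable[OF s], of "{..<n}"] sums_unique[OF s]
      by (intro integral_mono) auto
    finally show "(\<Sum>i<n. \<integral>x. norm (f i x) \<partial>M) \<le> (\<integral>x. exp (norm z * \<bar>x\<bar>) \<partial>M)" .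
  qed simp
  then have "(\<lambda>n. \<integral>x. f n x \<partial>M) sums (\<integral>x. (\<Sum>n. f n x) \<partial>M)"
    using fint sums_summable[OF s] by (intro sums_integral) auto
  moreover have "(\<Sum>n. f n x) = exp (z * of_real x)" for x
    unfolding f_def using exp_converges sums_unique by metis
  moreover have "(\<integral>x. f n x \<partial>M) = z ^ n / fact n * of_real (\<integral>x. x ^ n \<partial>M)" for n
  proof -
    have "(\<integral>x. f n x \<partial>M) = (\<integral>x. z ^ n / fact n * of_real (x ^ n) \<partial>M)"
      by (intro Bochner_Integration.integral_cong)
         (auto simp: f_def power_mult_distrib scaleR_conv_of_real field_simps)
    then show ?thesis
      using pint[of n] by (simp del: of_real_power)
  qed
  ultimately show ?thesis by simp
qed

text \<open>Real exponential moments fix all moments, these fix the characteristic function, and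
  Levy's theorem concludes. The total mass is arbitrary since the lemma is applied to weighted
  projections; so the measures are normalized first and mass zero is treated apart.\<close>

lemma real_measure_eqI_exp:
  fixes M N :: "real measure"
  assumes M: "sets M = sets borel" and N: "sets N = sets borel"
    and fin: "\<And>t. (\<integral>\<^sup>+x. exp (t * x) \<partial>M) < \<infinity>"
    and eq: "\<And>t. (\<integral>\<^sup>+x. exp (t * x) \<partial>M) = (\<integral>\<^sup>+x. exp (t * x) \<partial>N)"
  shows "M = N"
proof -
  note [measurable_cong] = M N
  have iM: "integrable M (\<lambda>x. exp (t * x))" for t
    using fin[of t] by (intro integrableI_bounded) auto
  have iN: "integrable N (\<lambda>x. exp (t * x))" for t
    using fin[of t] eq[of t] by (intro integrableI_bounded) auto
  have ie: "(\<integral>x. exp (t * x) \<partial>M) = (\<integral>x. exp (t * x) \<partial>N)" for t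
    using eq[of t] by (simp add: integral_eq_nn_integral)
  define a where "a n = ((\<integral>x. x ^ n \<partial>M) - (\<integral>x. x ^ n \<partial>N)) / fact n" for n
  have "(\<lambda>n. a n * t ^ n) sums 0" for t
  proof -
    have "(\<lambda>n. t ^ n / fact n * (\<integral>x. x ^ n \<partial>M) - t ^ n / fact n * (\<integral>x. x ^ n \<partial>N)) sums
        ((\<integral>x. exp (t * x) \<partial>M) - (\<integral>x. exp (t * x) \<partial>N))"
      using sums_diff[OF exp_integral_sums[OF M iM, of t] exp_integral_sums[OF N iN, of t]] by simp
    moreover have "t ^ n / fact n * (\<integral>x. x ^ n \<partial>M) - t ^ n / fact n * (\<integral>x. x ^ n \<partial>N) = a n * t ^ n" for n
      by (simp add: a_def field_simps)
    ultimately show ?thesis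
      by (simp add: ie)
  qed
  then have a0: "a n = 0" for n
    by (rule powser_coeffs_zero)
  have mom: "(\<integral>x. x ^ n \<partial>M) = (\<integral>x. x ^ n \<partial>N)" for n
    using a0[of n] by (simp add: a_def)
  have ce: "(\<integral>x. exp (z * of_real x) \<partial>M) = (\<integral>x. exp (z * of_real x) \<partial>N)" for z :: complex
    using exp_integral_sums[OF M iM, of z] exp_integral_sums[OF N iN, of z]
    unfolding mom by (rule sums_unique2)
  have mass: "emeasure M (space M) = emeasure N (space N)" "emeasure M (space M) < \<infinity>"
    using eq[of 0] fin[of 0] by simp_all
  have sp: "space M = UNIV" "space N = UNIV"
    using sets_eq_imp_space_eq[OF M] sets_eq_imp_space_eq[OF N] by auto
  show ?thesis
  proof (cases "emeasure M (space M) = 0")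
    case True
    then have "emeasure M A = 0 \<and> emeasure N A = 0" for A
      using mass emeasure_space[of M A] emeasure_space[of N A] by simp
    then show ?thesis
      by (intro measure_eqI) (auto simp: M N)
  next
    case False
    obtain c where c: "emeasure M (space M) = ennreal c" "c > 0"
      using mass(2) False
      by (cases "emeasure M (space M)") (auto simp: less_top zero_less_iff_neq_zero)
    define s where "s K = density K (\<lambda>_. ennreal (1 / c))" for K :: "real measure"
    have "ennreal (1 / c) * ennreal c = 1"
      using c by (simp add: ennreal_mult[symmetric])
    then have 1: "real_distribution (s M)" "real_distribution (s N)"
      using c mass(1) sp
      by (auto simp: s_def real_distribution_def real_distribution_axioms_def M N emeasure_density
          nn_integral_cmult intro!: prob_spaceI)
    have "char (s M) = char (s N)"
    proof
      fix t
      have "(CLINT x|K. exp (\<i> * of_real (t * x))) = (\<integral>x. exp ((\<i> * of_real t) * of_real x) \<partial>K)" for K :: "real measure"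
        by (simp add: mult.assoc)
      then show "char (s M) t = char (s N) t"
        using c ce[of "\<i> * of_real t"] unfolding char_def s_def
        by (subst (1 2) integral_density) (auto simp: mult.assoc)
    qed
    then have "s M = s N"
      using 1 Levy_uniqueness by blast
    then have "density (s M) (\<lambda>_. ennreal c) = density (s N) (\<lambda>_. ennreal c)"
      by simp
    then show ?thesis
      using c unfolding s_def
      by (simp add: density_density_eq ennreal_mult[symmetric] density_1)
  qed
qed


section \<open>Cylinder sets and uniqueness in Hilbert spaces\<close>

inductive_set cylinders :: "'a::real_inner set set" where
  UNIV: "UNIV \<in> cylinders"
| Int: "A \<in> cylinders \<Longrightarrow> B \<in> sets borel \<Longrightarrow> A \<inter> {x. inner x h \<in> B} \<in> cylinders"

lemma Int_stable_cylinders: "Int_stable cylinders"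
proof (rule Int_stableI)
  fix A B :: "'a set"
  assume "B \<in> cylinders" "A \<in> cylinders"
  then show "A \<inter> B \<in> cylinders"
  proof induction
    case (Int B C h)
    then show ?case
      using cylinders.Int[of "A \<inter> B" C h] by (simp add: Int_assoc)
  qed simp
qed

lemma cylinders_sets_borel:
  fixes A :: "'a::{real_inner,second_countable_topology} set"
  assumes "A \<in> cylinders"
  shows "A \<in> sets borel"
  using assms
proof induction
  case (Int A B h)
  have "(\<lambda>x. inner x h) -` B \<inter> space borel \<in> sets borel"
    using Int by (intro measurable_sets[of _ _ borel]) auto
  moreover have "(\<lambda>x. inner x h) -` B \<inter> space borel = {x. inner x h \<in> B}"
    by auto
  ultimately show ?case
    using Int by auto
qed simp

text \<open>A closed ball is the intersection of the half spaces that contain it, and normals from a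
  countable dense set suffice. Every open set is a countable union of closed balls with centres in
  that set.\<close>

lemma sets_borel_eq_cylinders:
  "sets (borel :: 'a::{real_inner,second_countable_topology} measure) = sigma_sets UNIV cylinders"
proof
  show "sigma_sets UNIV cylinders \<subseteq> sets (borel :: 'a measure)"
    by (metis cylinders_sets_borel sets.sigma_sets_subset space_borel subsetI)
next
  obtain D :: "'a set" where D: "countable D" "\<And>X. open X \<Longrightarrow> X \<noteq> {} \<Longrightarrow> \<exists>d\<in>D. d \<in> X"
    using countable_dense_setE by blast
  define S where "S = sigma (UNIV :: 'a set) cylinders"
  have sS: "sets S = sigma_sets UNIV cylinders"
    unfolding S_def by simp
  have half: "{x. inner x h \<in> B} \<in> sets S" if "B \<in> sets borel" for B and h :: 'a
    using cylinders.Int[OF cylinders.UNIV that, of h] unfolding sS by (auto intro: sigma_sets.Basic)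
  have cball: "cball z r \<in> sets S" if "r \<ge> 0" for z :: 'a and r
  proof -
    have "cball z r = (\<Inter>d\<in>D. {x. inner x d \<in> {..inner z d + r * norm d}})"
    proof (intro set_eqI iffI)
      fix x assume "x \<in> cball z r"
      then have "norm (x - z) \<le> r"
        by (simp add: dist_norm norm_minus_commute)
      then have "inner (x - z) d \<le> r * norm d" for d
        by (meson mult_right_mono norm_cauchy_schwarz norm_ge_zero order_trans)
      then show "x \<in> (\<Inter>d\<in>D. {x. inner x d \<in> {..inner z d + r * norm d}})"
        by (auto simp: inner_diff_left algebra_simps)
    next
      fix x assume x: "x \<in> (\<Inter>d\<in>D. {x. inner x d \<in> {..inner z d + r * norm d}})"
      show "x \<in> cball z r"
      proof (rule ccontr)
        assume "x \<notin> cball z r"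
        then have "norm (x - z) > r"
          by (simp add: dist_norm norm_minus_commute)
        \<comment> \<open>The open set of normals whose half space excludes x. It contains x - z, so
          it meets the dense set.\<close>
        define U where "U = {d. r * norm d < inner (x - z) d}"
        have "open U"
          unfolding U_def by (intro open_Collect_less continuous_intros)
        moreover have "x - z \<in> U"
          using \<open>norm (x - z) > r\<close> \<open>r \<ge> 0\<close>
          using mult_strict_right_mono[OF \<open>norm (x - z) > r\<close> le_less_trans[OF \<open>r \<ge> 0\<close> \<open>norm (x - z) > r\<close>]]
          by (simp add: U_def power2_norm_eq_inner[symmetric] power2_eq_square)
        then have "U \<noteq> {}" by auto
        ultimately obtain d where "d \<in> D" "r * norm d < inner (x - z) d"
          using D(2)[of U] by (auto simp: U_def)
        then show False
          using x by (auto simp: inner_diff_left algebra_simps not_le[symmetric])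
      qed
    qed
    moreover have "D \<noteq> {}"
      using D(2)[of UNIV] by auto
    ultimately show ?thesis
      using D(1) by (simp only:) (intro sets.countable_INT' image_subsetI half, auto)
  qed
  have "U \<in> sets S" if "open U" for U
  proof -
    define J where "J = {(d, n::nat). d \<in> D \<and> cball d (1 / Suc n) \<subseteq> U}"
    have "countable J"
      by (rule countable_subset[of _ "D \<times> UNIV"]) (auto simp: J_def D)
    have "U = (\<Union>(d, n)\<in>J. cball d (1 / Suc n))"
    proof (intro set_eqI iffI)
      fix x assume "x \<in> U"
      then obtain e where e: "e > 0" "ball x e \<subseteq> U"
        using \<open>open U\<close> openE by blast
      obtain n where n: "1 / Suc n < e / 2"
        using e by (metis half_gt_zero nat_approx_posE)
      obtain d where d: "d \<in> D" "d \<in> ball x (1 / Suc n)"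
        using D(2)[of "ball x (1 / Suc n)"] by auto
      have "cball d (1 / Suc n) \<subseteq> ball x e"
      proof
        fix y assume "y \<in> cball d (1 / Suc n)"
        with d n have "dist x d < e / 2" "dist d y \<le> e / 2" by auto
        then show "y \<in> ball x e"
          using dist_triangle[of x y d] by auto
      qed
      with e d show "x \<in> (\<Union>(d, n)\<in>J. cball d (1 / Suc n))"
        using \<open>cball d (1 / Suc n) \<subseteq> ball x e\<close>
        by (intro UN_I[of "(d, n)"]) (auto simp: J_def dist_commute less_imp_le)
    qed (auto simp: J_def)
    with \<open>countable J\<close> show ?thesis
      using cball by (auto intro!: sets.countable_UN')
  qed
  then have "{U :: 'a set. open U} \<subseteq> sets S" by auto
  then have "sigma_sets UNIV {U :: 'a set. open U} \<subseteq> sets S"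
    using sets.sigma_sets_subset[of _ S] by (simp add: S_def)
  then show "sets (borel :: 'a measure) \<subseteq> sigma_sets UNIV cylinders"
    unfolding sS by (simp add: borel_def)
qed

text \<open>The exponential weights are kept during the induction over cylinders. Restrict the
  measure with weight exp <x, k> to a cylinder A and project it along h: the Laplace transform at t
  is the integral over A with weight k + t h, which the induction hypothesis knows. The
  one-dimensional theorem then permits one more condition on <x, h>.\<close>

lemma measure_eqI_exp_inner:
  fixes M N :: "'a::{real_inner,second_countable_topology} measure"
  assumes M: "sets M = sets borel" and N: "sets N = sets borel"
    and fin: "\<And>k. (\<integral>\<^sup>+x. exp (inner x k) \<partial>M) < \<infinity>"
    and eq: "\<And>k. (\<integral>\<^sup>+x. exp (inner x k) \<partial>M) = (\<integral>\<^sup>+x. exp (inner x k) \<partial>N)"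
  shows "M = N"
proof (rule measure_eqI_generator_eq[OF Int_stable_cylinders])
  note [measurable_cong] = M N
  have *: "(\<integral>\<^sup>+x. indicator A x * ennreal (exp (inner x k)) \<partial>M) =
      (\<integral>\<^sup>+x. indicator A x * ennreal (exp (inner x k)) \<partial>N)" if "A \<in> cylinders" for A k
    using that
  proof (induction arbitrary: k)
    case (Int A B h)
    note [measurable] = cylinders_sets_borel[OF Int(1)] Int(2)
    have half: "{x. inner x h \<in> B} \<in> sets borel"
      using cylinders_sets_borel[OF cylinders.Int[OF cylinders.UNIV Int(2), of h]] by simp
    define L where "L K = distr (density K (\<lambda>x. indicator A x * ennreal (exp (inner x k)))) borel
      (\<lambda>x. inner x h)" for K :: "'a measure"
    have L: "(\<integral>\<^sup>+s. exp (t * s) \<partial>L K) = (\<integral>\<^sup>+x. indicator A x * ennreal (exp (inner x (k + t *\<^sub>R h))) \<partial>K)"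
      if [measurable_cong]: "sets K = sets borel" for K t
    proof -
      have "(\<integral>\<^sup>+s. exp (t * s) \<partial>L K) =
          (\<integral>\<^sup>+x. exp (t * inner x h) \<partial>density K (\<lambda>x. indicator A x * ennreal (exp (inner x k))))"
        unfolding L_def by (rule nn_integral_distr) simp_all
      also have "\<dots> = (\<integral>\<^sup>+x. indicator A x * ennreal (exp (inner x k)) * ennreal (exp (t * inner x h)) \<partial>K)"
        by (rule nn_integral_density) simp_all
      also have "\<dots> = (\<integral>\<^sup>+x. indicator A x * ennreal (exp (inner x (k + t *\<^sub>R h))) \<partial>K)"
        by (simp add: inner_add_right exp_add ennreal_mult mult.assoc)
      finally show ?thesis .
    qed
    have "L M = L N"
    proof (rule real_measure_eqI_exp)
      fix t
      show "(\<integral>\<^sup>+s. exp (t * s) \<partial>L M) = (\<integral>\<^sup>+s. exp (t * s) \<partial>L N)"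
        using Int.IH L[OF M] L[OF N] by simp
      have "(\<integral>\<^sup>+s. exp (t * s) \<partial>L M) \<le> (\<integral>\<^sup>+x. exp (inner x (k + t *\<^sub>R h)) \<partial>M)"
        unfolding L[OF M] by (intro nn_integral_mono) (auto split: split_indicator)
      then show "(\<integral>\<^sup>+s. exp (t * s) \<partial>L M) < \<infinity>"
        using fin[of "k + t *\<^sub>R h"] by (rule le_less_trans)
    qed (auto simp: L_def)
    moreover have "emeasure (L K) B =
        (\<integral>\<^sup>+x. indicator (A \<inter> {x. inner x h \<in> B}) x * ennreal (exp (inner x k)) \<partial>K)"
      if [measurable_cong]: "sets K = sets borel" for K
    proof -
      have sp: "space K = UNIV"
        using sets_eq_imp_space_eq[OF that] by simp
      have "emeasure (L K) B = emeasure (density K (\<lambda>x. indicator A x * ennreal (exp (inner x k))))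
          {x. inner x h \<in> B}"
        unfolding L_def by (subst emeasure_distr) (simp_all add: sp vimage_def Int(2))
      also have "\<dots> = (\<integral>\<^sup>+x. indicator A x * ennreal (exp (inner x k)) * indicator {x. inner x h \<in> B} x \<partial>K)"
        using half by (intro emeasure_density) (simp_all add: that)
      also have "\<dots> = (\<integral>\<^sup>+x. indicator (A \<inter> {x. inner x h \<in> B}) x * ennreal (exp (inner x k)) \<partial>K)"
        by (intro nn_integral_cong) (simp split: split_indicator)
      finally show ?thesis .
    qed
    from this[OF M] this[OF N] calculation show ?case
      by simp
  qed (simp add: eq)
  show "emeasure M A = emeasure N A" if "A \<in> cylinders" for A
    using *[OF that, of 0] cylinders_sets_borel[OF that] by (simp add: M N)
  show "sets M = sigma_sets UNIV cylinders" "sets N = sigma_sets UNIV cylinders"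
    using M N sets_borel_eq_cylinders by auto
  show "range (\<lambda>_::nat. UNIV) \<subseteq> cylinders" "(\<Union>n::nat. UNIV) = UNIV"
    by (auto intro: cylinders.UNIV)
  show "emeasure M UNIV \<noteq> \<infinity>"
    using fin[of 0] sets_eq_imp_space_eq[OF M] by simp
qed auto

section \<open>Eigenbases and square roots\<close>

locale orthonormal_seq =
  fixes e :: "nat \<Rightarrow> 'a::{real_inner,complete_space}"
  assumes ortho: "i \<noteq> j \<Longrightarrow> inner (e i) (e j) = 0"
    and unit: "e i = 0 \<or> norm (e i) = 1"
begin

lemma inner_e_le_1: "inner (e i) (e i) \<le> 1"
  using unit[of i] by (auto simp: power2_norm_eq_inner[symmetric])

lemma inner_e_cancel: "inner x (e i) * inner (e i) (e i) = inner x (e i)"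
  using unit[of i] by (auto simp: power2_norm_eq_inner[symmetric])

lemma inner_sum_e:
  assumes "finite I"
  shows "inner (\<Sum>i\<in>I. a i *\<^sub>R e i) (e j) = (if j \<in> I then a j * inner (e j) (e j) else 0)"
proof -
  have "inner (\<Sum>i\<in>I. a i *\<^sub>R e i) (e j) = (\<Sum>i\<in>I. if i = j then a j * inner (e j) (e j) else 0)"
    unfolding inner_sum_left by (intro sum.cong) (auto simp: ortho)
  then show ?thesis
    using assms by simp
qed

lemma norm_sum_e:
  assumes "finite I"
  shows "(norm (\<Sum>i\<in>I. a i *\<^sub>R e i))\<^sup>2 = (\<Sum>i\<in>I. (a i)\<^sup>2 * inner (e i) (e i))"
proof -
  have "(norm (\<Sum>i\<in>I. a i *\<^sub>R e i))\<^sup>2 = (\<Sum>j\<in>I. a j * inner (\<Sum>i\<in>I. a i *\<^sub>R e i) (e j))"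
    unfolding power2_norm_eq_inner by (simp add: inner_sum_right)
  also have "\<dots> = (\<Sum>j\<in>I. (a j)\<^sup>2 * inner (e j) (e j))"
    using assms by (intro sum.cong) (auto simp: inner_sum_e power2_eq_square)
  finally show ?thesis .
qed

lemma norm_sum_e_le:
  assumes "finite I"
  shows "(norm (\<Sum>i\<in>I. a i *\<^sub>R e i))\<^sup>2 \<le> (\<Sum>i\<in>I. (a i)\<^sup>2)"
  unfolding norm_sum_e[OF assms] by (intro sum_mono mult_left_le) (auto simp: inner_e_le_1)

lemma summable_e:
  assumes "summable (\<lambda>i. (a i)\<^sup>2)"
  shows "summable (\<lambda>i. a i *\<^sub>R e i)"
proof -
  have "Cauchy (\<lambda>n. \<Sum>i<n. a i *\<^sub>R e i)"
  proof (rule metric_CauchyI)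
    fix r :: real assume "r > 0"
    then obtain N where N: "\<And>m n. m \<ge> N \<Longrightarrow> norm (\<Sum>i=m..<n. (a i)\<^sup>2) < r\<^sup>2"
      using assms unfolding summable_Cauchy by (metis zero_less_power)
    have *: "dist (\<Sum>i<m. a i *\<^sub>R e i) (\<Sum>i<n. a i *\<^sub>R e i) < r" if "N \<le> m" "m \<le> n" for m n
    proof -
      have "(\<Sum>i<n. a i *\<^sub>R e i) = (\<Sum>i<m. a i *\<^sub>R e i) + (\<Sum>i=m..<n. a i *\<^sub>R e i)"
        using that(2) by (metis atLeast0LessThan le0 sum.atLeastLessThan_concat)
      then have "(dist (\<Sum>i<m. a i *\<^sub>R e i) (\<Sum>i<n. a i *\<^sub>R e i))\<^sup>2 = (norm (\<Sum>i=m..<n. a i *\<^sub>R e i))\<^sup>2"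
        by (simp add: dist_norm)
      also have "\<dots> \<le> (\<Sum>i=m..<n. (a i)\<^sup>2)"
        by (rule norm_sum_e_le) simp
      also have "\<dots> < r\<^sup>2"
        using N[OF that(1), of n] by simp
      finally show ?thesis
        using \<open>r > 0\<close> by (simp add: power2_less_imp_less)
    qed
    show "\<exists>M. \<forall>m\<ge>M. \<forall>n\<ge>M. dist (\<Sum>i<m. a i *\<^sub>R e i) (\<Sum>i<n. a i *\<^sub>R e i) < r"
      using * by (metis dist_commute nle_le)
  qed
  then show ?thesis
    by (simp add: summable_iff_convergent Cauchy_convergent_iff)
qed

lemma bessel: "(\<Sum>i\<in>{..<n}. (inner x (e i))\<^sup>2) \<le> (norm x)\<^sup>2"
proof -
  define p where "p = (\<Sum>i<n. inner x (e i) *\<^sub>R e i)"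
  have "(norm p)\<^sup>2 = (\<Sum>i<n. (inner x (e i))\<^sup>2)"
    unfolding p_def by (subst norm_sum_e) (auto simp: power2_eq_square mult.assoc inner_e_cancel)
  moreover have "inner x p = (\<Sum>i<n. (inner x (e i))\<^sup>2)"
    unfolding p_def by (simp add: inner_sum_right power2_eq_square)
  moreover have "(norm (x - p))\<^sup>2 = (norm x)\<^sup>2 - 2 * inner x p + (norm p)\<^sup>2"
    unfolding power2_norm_eq_inner by (simp add: inner_diff_left inner_diff_right inner_commute)
  moreover have "0 \<le> (norm (x - p))\<^sup>2" by simp
  ultimately show ?thesis by linarith
qed

lemma summable_coeff: "summable (\<lambda>i. (inner x (e i))\<^sup>2)"
  by (rule summableI_nonneg_bounded[OF _ bessel]) simp

lemma inner_suminf_e: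
  assumes "summable (\<lambda>i. (a i)\<^sup>2)"
  shows "(\<lambda>i. a i * inner (e i) y) sums inner (\<Sum>i. a i *\<^sub>R e i) y"
  using bounded_linear.sums[OF bounded_linear_inner_left summable_sums[OF summable_e[OF assms]], of y]
  by simp

lemma inner_suminf_e_same:
  assumes "summable (\<lambda>i. (a i)\<^sup>2)"
  shows "inner (\<Sum>i. a i *\<^sub>R e i) (e j) = a j * inner (e j) (e j)"
proof -
  have "(\<lambda>i. a i * inner (e i) (e j)) = (\<lambda>i. if i = j then a i * inner (e i) (e j) else 0)"
    using ortho by auto
  then have "(\<lambda>i. a i * inner (e i) (e j)) sums (a j * inner (e j) (e j))"
    using sums_single[of j "\<lambda>i. a i * inner (e i) (e j)"] by simp
  with inner_suminf_e[OF assms, of "e j"] show ?thesis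
    by (rule sums_unique2)
qed

end

text \<open>At an index with \<open>e i = 0\<close> any positive \<open>l i\<close> satisfies
  \<open>eigen\<close>; requiring positivity everywhere lets one divide by \<open>l i\<close>
  without case distinctions.\<close>

locale eigenbasis = orthonormal_seq e
  for e :: "nat \<Rightarrow> 'a::{real_inner,complete_space}" +
  fixes C :: "'a \<Rightarrow> 'a" and l :: "nat \<Rightarrow> real"
  assumes total: "(\<And>i. inner x (e i) = 0) \<Longrightarrow> x = 0"
    and pos: "positive_operator C"
    and l_pos: "0 < l i"
    and eigen: "C (e i) = l i *\<^sub>R e i"
begin

lemma bl: "bounded_linear C" and sa: "inner (C x) y = inner x (C y)"
  using pos by (auto simp: positive_operator_def)

lemma inner_eqI: "(\<And>i. inner x (e i) = inner y (e i)) \<Longrightarrow> x = y"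
  using total[of "x - y"] by (simp add: inner_diff_left)

text \<open>The series converges by Bessel's inequality, its limit has the coefficients of x, and
  totality identifies the two.\<close>

lemma expansion: "(\<lambda>i. inner x (e i) *\<^sub>R e i) sums x"
proof -
  have "(\<Sum>i. inner x (e i) *\<^sub>R e i) = x"
    by (rule inner_eqI) (simp add: inner_suminf_e_same[OF summable_coeff] inner_e_cancel)
  then show ?thesis
    using summable_sums[OF summable_e[OF summable_coeff[of x]]] by simp
qed

lemma parseval: "(\<lambda>i. inner x (e i) * inner y (e i)) sums inner x y"
  using bounded_linear.sums[OF bounded_linear_inner_left expansion[of x], of y]
  by (simp add: inner_commute)

lemma parseval_norm: "(\<lambda>i. (inner x (e i))\<^sup>2) sums (norm x)\<^sup>2"
  unfolding power2_norm_eq_inner using parseval[of x x] by (simp add: power2_eq_square)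

lemma inner_C_e: "inner (C x) (e i) = l i * inner x (e i)"
  by (simp add: sa eigen)

lemma parseval_C: "(\<lambda>i. l i * (inner x (e i))\<^sup>2) sums inner (C x) x"
  using parseval[of "C x" x] by (simp add: inner_C_e power2_eq_square mult.assoc)

section \<open>The square root in an eigenbasis\<close>

definition S :: "'a \<Rightarrow> 'a" where
  "S x = (\<Sum>i. (sqrt (l i) * inner x (e i)) *\<^sub>R e i)"

lemma S_coeff: "summable (\<lambda>i. (sqrt (l i) * inner x (e i))\<^sup>2)"
  using sums_summable[OF parseval_C] l_pos by (simp add: power_mult_distrib less_imp_le)

lemma inner_S_e: "inner (S x) (e i) = sqrt (l i) * inner x (e i)"
  unfolding S_def by (simp add: inner_suminf_e_same[OF S_coeff] mult.assoc inner_e_cancel)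

lemma inner_S: "(\<lambda>i. sqrt (l i) * inner x (e i) * inner y (e i)) sums inner (S x) y"
  using parseval[of "S x" y] by (simp add: inner_S_e)

lemma S_S: "S (S x) = C x"
  by (rule inner_eqI) (use l_pos in \<open>simp add: inner_S_e inner_C_e less_imp_le flip: mult.assoc\<close>)

lemma S_sym: "inner (S x) y = inner x (S y)"
  using inner_S[of x y] inner_S[of y x] sums_unique2
  by (fastforce simp: inner_commute[of x "S y"] mult.assoc mult.commute mult.left_commute)

lemma norm_S: "(norm (S x))\<^sup>2 = inner (C x) x"
  by (simp add: power2_norm_eq_inner S_sym S_S flip: sa)

lemma positive_S: "positive_operator S"
  unfolding positive_operator_def
proof (intro conjI allI)
  obtain K where K: "norm (C x) \<le> norm x * K" for x
    using bounded_linear.bounded[OF bl] by blast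
  show "bounded_linear S"
  proof (rule bounded_linear_intro[where K = "sqrt \<bar>K\<bar>"])
    show "S (x + y) = S x + S y" for x y
      by (rule inner_eqI) (simp add: inner_S_e inner_add_left algebra_simps)
    show "S (r *\<^sub>R x) = r *\<^sub>R S x" for r x
      by (rule inner_eqI) (simp add: inner_S_e)
    fix x
    have "(norm (S x))\<^sup>2 \<le> norm (C x) * norm x"
      unfolding norm_S by (rule norm_cauchy_schwarz)
    also have "\<dots> \<le> (norm x * \<bar>K\<bar>) * norm x"
      by (intro mult_right_mono order_trans[OF K] mult_left_mono) auto
    also have "\<dots> = (norm x * sqrt \<bar>K\<bar>)\<^sup>2"
      by (simp add: power_mult_distrib power2_eq_square)
    finally show "norm (S x) \<le> norm x * sqrt \<bar>K\<bar>"
      by (rule power2_le_imp_le) simp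
  qed
  show "inner (S x) y = inner x (S y)" for x y
    by (rule S_sym)
  show "0 \<le> inner (S x) x" for x
    using l_pos by (intro sums_le[OF _ sums_zero inner_S]) (simp add: mult.assoc less_imp_le)
qed

text \<open>R + sqrt (l i) annihilates d = (R - sqrt (l i)) (e i), because R squared is C. As R is
  nonnegative, R + sqrt (l i) is injective, so d = 0 and R agrees with S on the basis.\<close>

lemma square_root_unique:
  assumes R: "positive_operator R" and RR: "R \<circ> R = C"
  shows "R = S"
proof -
  interpret R: bounded_linear R
    using R by (simp add: positive_operator_def)
  have R_e: "R (e i) = sqrt (l i) *\<^sub>R e i" for i
  proof -
    define d where "d = R (e i) - sqrt (l i) *\<^sub>R e i"
    have "R (R (e i)) = l i *\<^sub>R e i"
      using RR eigen by (metis comp_apply)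
    then have "R d + sqrt (l i) *\<^sub>R d = 0"
      using l_pos[of i] by (simp add: d_def R.diff R.scaleR scaleR_diff_right less_imp_le)
    then have "inner (R d) d + sqrt (l i) * (norm d)\<^sup>2 = 0"
      by (metis inner_add_left inner_scaleR_left inner_zero_left power2_norm_eq_inner)
    moreover have "0 \<le> inner (R d) d"
      using R unfolding positive_operator_def by blast
    ultimately have "sqrt (l i) * (norm d)\<^sup>2 \<le> 0" by linarith
    then have "d = 0"
      using l_pos[of i] by (simp add: mult_le_0_iff)
    then show ?thesis
      by (simp add: d_def)
  qed
  have "inner (R x) (e i) = inner (S x) (e i)" for x i
    using R by (simp add: positive_operator_def R_e inner_S_e)
  then show ?thesis
    by (intro ext inner_eqI)
qed

lemma op_sqrt_eq: "op_sqrt C = S"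
  unfolding op_sqrt_def
  by (rule the_equality) (auto simp: positive_S S_S square_root_unique)

lemma inj_S: "inj S"
proof (rule injI)
  fix x y assume "S x = S y"
  then have "sqrt (l i) * inner x (e i) = sqrt (l i) * inner y (e i)" for i
    by (metis inner_S_e)
  then show "x = y"
    using l_pos by (intro inner_eqI) (simp add: less_le)
qed

end

section \<open>The spectral theorem for trace class operators\<close>

lemma positive_operatorD:
  assumes "positive_operator T"
  shows "bounded_linear T" "inner (T x) y = inner x (T y)" "0 \<le> inner (T x) x"
  using assms unfolding positive_operator_def by blast+

lemma positive_operator_cauchy_schwarz:
  assumes "positive_operator T"
  shows "(inner (T x) y)\<^sup>2 \<le> inner (T x) x * inner (T y) y"
proof -
  interpret bounded_linear T
    using assms by (simp add: positive_operator_def)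
  have sa: "inner (T y) x = inner (T x) y"
    using positive_operatorD(2)[OF assms, of x y] by (simp add: inner_commute)
  have nn: "0 \<le> inner (T z) z" for z
    using positive_operatorD(3)[OF assms] .
  have q: "0 \<le> inner (T x) x + 2 * t * inner (T x) y + t\<^sup>2 * inner (T y) y" for t
  proof -
    have "inner (T (x + t *\<^sub>R y)) (x + t *\<^sub>R y) =
        inner (T x) x + 2 * t * inner (T x) y + t\<^sup>2 * inner (T y) y"
      by (simp add: add scaleR inner_add_left inner_add_right sa power2_eq_square algebra_simps)
    then show ?thesis
      using nn by metis
  qed
  show ?thesis
  proof (cases "inner (T y) y = 0")
    case True
    have "inner (T x) y = 0"
    proof (rule ccontr)
      assume "inner (T x) y \<noteq> 0"
      \<comment> \<open>For this t the quadratic polynomial, which is affine in the degenerate case,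
        takes the value -1.\<close>
      then have "2 * (- (inner (T x) x + 1) / (2 * inner (T x) y)) * inner (T x) y = - (inner (T x) x + 1)"
        by simp
      then show False
        using q[of "- (inner (T x) x + 1) / (2 * inner (T x) y)", unfolded True mult_zero_right]
        by linarith
    qed
    then show ?thesis
      using nn[of x] True by simp
  next
    case False
    then have c: "inner (T y) y > 0"
      using nn[of y] by simp
    have "0 \<le> inner (T x) x - (inner (T x) y)\<^sup>2 / inner (T y) y"
      using q[of "- inner (T x) y / inner (T y) y"] c by (simp add: power2_eq_square field_simps)
    then show ?thesis
      using c by (simp add: field_simps)
  qed
qed

text \<open>Cauchy-Schwarz for the form of T at x and T x. The bound L is demanded at T x alone, so
  L may be a global norm bound or the supremum of the form on an invariant subspace.\<close>

lemma positive_operator_norm_le: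
  assumes T: "positive_operator T" and L: "inner (T (T x)) (T x) \<le> L * (norm (T x))\<^sup>2"
  shows "(norm (T x))\<^sup>2 \<le> L * inner (T x) x"
proof (cases "T x = 0")
  case False
  have "(norm (T x))\<^sup>2 * (norm (T x))\<^sup>2 = (inner (T x) (T x))\<^sup>2"
    unfolding power2_norm_eq_inner by (rule power2_eq_square[symmetric])
  also have "\<dots> \<le> inner (T x) x * inner (T (T x)) (T x)"
    by (rule positive_operator_cauchy_schwarz[OF T])
  also have "\<dots> \<le> inner (T x) x * (L * (norm (T x))\<^sup>2)"
    using positive_operatorD(3)[OF T] L by (intro mult_left_mono)
  finally show ?thesis
    using False by (metis mult.assoc mult.commute mult_le_cancel_right_pos zero_less_norm_iff zero_less_power)
qed simp

lemma positive_operator_inner_eq_0: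
  assumes "positive_operator T" "inner (T x) x = 0"
  shows "T x = 0"
  using positive_operator_cauchy_schwarz[OF assms(1), of x "T x"] assms(2) by simp

section \<open>Compactness of positive trace class operators\<close>

lemma compact_bounded_coefficients:
  fixes g :: "'b \<Rightarrow> 'a::real_normed_vector"
  assumes "finite F"
  shows "compact ((\<lambda>a. \<Sum>x\<in>F. a x *\<^sub>R g x) ` {a. \<forall>x\<in>F. \<bar>a x\<bar> \<le> (1::real)})"
  using assms
proof induction
  case empty
  have "(\<lambda>a::'b \<Rightarrow> real. \<Sum>x\<in>{}. a x *\<^sub>R g x) ` {a. \<forall>x\<in>{}. \<bar>a x\<bar> \<le> 1} = {0}"
    by auto
  then show ?case
    by (metis compact_sing)
next
  case (insert y F)
  define f where "f F a = (\<Sum>x\<in>F. a x *\<^sub>R g x)" for F and a :: "'b \<Rightarrow> real"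
  define U where "U F = {a. \<forall>x\<in>F. \<bar>a x\<bar> \<le> (1::real)}" for F :: "'b set"
  define B where "B = (\<lambda>t. t *\<^sub>R g y) ` {-1..1::real}"
  have f_insert: "f (insert y F) a = a y *\<^sub>R g y + f F a" for a
    using insert unfolding f_def by simp
  have f_upd: "f F (a(y := t)) = f F a" for a t
    unfolding f_def by (intro sum.cong) (use insert.hyps in auto)
  \<comment> \<open>A new vector adds a segment, so the set is a Minkowski sum of two compact
    sets.\<close>
  have "f (insert y F) ` U (insert y F) = {u + v | u v. u \<in> B \<and> v \<in> f F ` U F}" (is "?L = ?R")
  proof (rule subset_antisym; rule subsetI)
    fix z assume "z \<in> ?L"
    then obtain a where a: "a \<in> U (insert y F)" "z = f (insert y F) a"
      by (elim imageE)
    then have "a y *\<^sub>R g y \<in> B" "f F a \<in> f F ` U F"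
      by (auto simp: U_def B_def abs_le_iff)
    then show "z \<in> ?R"
      unfolding a(2) f_insert by (intro CollectI exI[of _ "a y *\<^sub>R g y"] exI[of _ "f F a"] conjI refl)
  next
    fix z assume "z \<in> ?R"
    then obtain u v where uv: "z = u + v" "u \<in> B" "v \<in> f F ` U F"
      by (elim CollectE exE conjE)
    obtain t where t: "t \<in> {-1..1}" "u = t *\<^sub>R g y"
      using uv(2) unfolding B_def by (elim imageE)
    obtain a where a: "a \<in> U F" "v = f F a"
      using uv(3) by (elim imageE)
    have "a(y := t) \<in> U (insert y F)"
      using a(1) t(1) by (auto simp: U_def abs_le_iff)
    moreover have "z = f (insert y F) (a(y := t))"
      unfolding f_insert f_upd uv(1) t(2) a(2) by simp
    ultimately show "z \<in> ?L"
      by (simp only: imageI)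
  qed
  moreover have "compact (f F ` U F)"
    using insert.IH unfolding f_def U_def .
  moreover have "compact B"
    unfolding B_def by (intro compact_continuous_image continuous_intros compact_Icc)
  ultimately have "compact (f (insert y F) ` U (insert y F))"
    using compact_sums[of B "f F ` U F"] by (simp only:)
  then show ?case
    unfolding f_def U_def .
qed

lemma orthonormal_sum_norm:
  assumes "finite G" "pairwise orthogonal G" "\<And>e. e \<in> G \<Longrightarrow> norm e = 1"
  shows "(norm (\<Sum>e\<in>G. a e *\<^sub>R e))\<^sup>2 = (\<Sum>e\<in>G. (a e)\<^sup>2)"
proof -
  have "(norm (\<Sum>e\<in>G. a e *\<^sub>R e))\<^sup>2 = (\<Sum>e\<in>G. (norm (a e *\<^sub>R e))\<^sup>2)"
    using assms by (intro norm_sum_Pythagorean) (auto simp: pairwise_def orthogonal_def)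
  then show ?thesis
    using assms by (simp add: power_mult_distrib)
qed

text \<open>Cauchy-Schwarz twice: for the form, giving |<T e, f>| <= q e * q f, and then for the
  resulting sum of the terms |a e| * q e.\<close>

lemma positive_operator_orthonormal_sum_le:
  assumes T: "positive_operator T"
    and G: "finite G" "pairwise orthogonal G" "\<And>e. e \<in> G \<Longrightarrow> norm e = 1"
    and x: "x = (\<Sum>e\<in>G. a e *\<^sub>R e)"
  shows "inner (T x) x \<le> (\<Sum>e\<in>G. inner (T e) e) * (norm x)\<^sup>2"
proof -
  interpret bounded_linear T
    using T by (simp add: positive_operator_def)
  have nn: "0 \<le> inner (T z) z" for z
    using positive_operatorD(3)[OF T] .
  have nx: "(norm x)\<^sup>2 = (\<Sum>e\<in>G. (a e)\<^sup>2)"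
    unfolding x by (rule orthonormal_sum_norm[OF G])
  define q where "q e = sqrt (inner (T e) e)" for e
  have "inner (T x) x = (\<Sum>e\<in>G. \<Sum>f\<in>G. a e * (a f * inner (T e) f))"
    unfolding x by (simp add: sum scaleR inner_sum_left inner_sum_right sum_distrib_left)
       (subst sum.swap, simp add: mult_ac)
  also have "\<dots> \<le> (\<Sum>e\<in>G. \<Sum>f\<in>G. (\<bar>a e\<bar> * q e) * (\<bar>a f\<bar> * q f))"
  proof (intro sum_mono)
    fix e f
    have "\<bar>inner (T e) f\<bar> \<le> q e * q f"
      using real_sqrt_le_mono[OF positive_operator_cauchy_schwarz[OF T, of e f]]
      by (simp add: q_def real_sqrt_mult)
    then have "\<bar>a e\<bar> * (\<bar>a f\<bar> * \<bar>inner (T e) f\<bar>) \<le> \<bar>a e\<bar> * (\<bar>a f\<bar> * (q e * q f))"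
      by (intro mult_left_mono) auto
    moreover have "a e * (a f * inner (T e) f) \<le> \<bar>a e\<bar> * (\<bar>a f\<bar> * \<bar>inner (T e) f\<bar>)"
      by (metis abs_ge_self abs_mult)
    ultimately show "a e * (a f * inner (T e) f) \<le> (\<bar>a e\<bar> * q e) * (\<bar>a f\<bar> * q f)"
      by (simp add: mult_ac)
  qed
  also have "\<dots> = (\<Sum>e\<in>G. \<bar>a e\<bar> * q e)\<^sup>2"
    by (simp add: power2_eq_square sum_product)
  also have "\<dots> \<le> (\<Sum>e\<in>G. \<bar>a e\<bar>\<^sup>2) * (\<Sum>e\<in>G. (q e)\<^sup>2)"
    by (rule Cauchy_Schwarz_ineq_sum)
  also have "\<dots> = (norm x)\<^sup>2 * (\<Sum>e\<in>G. inner (T e) e)"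
    using nn nx by (simp add: q_def)
  finally show ?thesis
    by (simp add: mult.commute)
qed

text \<open>Off the span of finitely many basis vectors the form of T is bounded by the remaining
  part of the trace. This is checked on finite linear combinations and extends by density, both
  sides being continuous in x.\<close>

lemma trace_class_tail:
  fixes T :: "'a::real_inner \<Rightarrow> 'a"
  assumes T: "positive_operator T" and "trace_class T" and d: "d > 0"
  obtains F where "finite F" "\<And>e. e \<in> F \<Longrightarrow> norm e = 1"
    and "\<And>x. let r = x - (\<Sum>e\<in>F. inner x e *\<^sub>R e) in inner (T r) r \<le> d * (norm x)\<^sup>2"
proof -
  interpret bounded_linear T
    using T by (simp add: positive_operator_def)
  have nn: "0 \<le> inner (T z) z" for z
    using positive_operatorD(3)[OF T] .
  obtain E where E: "pairwise orthogonal E" "\<And>e. e \<in> E \<Longrightarrow> norm e = 1" "closure (span E) = UNIV"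
    and sm: "(\<lambda>e. inner (T e) e) summable_on E"
    using assms(2) by (auto simp: trace_class_def orthonormal_basis_def)
  define s where "s = infsum (\<lambda>e. inner (T e) e) E"
  have "((\<lambda>e. inner (T e) e) has_sum s) E"
    unfolding s_def using sm by simp
  then have "\<forall>\<^sub>F F in finite_subsets_at_top E. s - d < (\<Sum>e\<in>F. inner (T e) e)"
    unfolding has_sum_def using d by (intro order_tendstoD) auto
  then obtain F where F: "finite F" "F \<subseteq> E" "s - d < (\<Sum>e\<in>F. inner (T e) e)"
    unfolding eventually_finite_subsets_at_top by blast
  have tail: "(\<Sum>e\<in>G. inner (T e) e) \<le> d" if "finite G" "G \<subseteq> E - F" for G
  proof -
    have "(\<Sum>e\<in>F \<union> G. inner (T e) e) \<le> s"
      unfolding s_def using that F sm nn by (intro finite_sum_le_infsum) auto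
    moreover have "(\<Sum>e\<in>F \<union> G. inner (T e) e) = (\<Sum>e\<in>F. inner (T e) e) + (\<Sum>e\<in>G. inner (T e) e)"
      using that F by (intro sum.union_disjoint) auto
    ultimately show ?thesis
      using F by linarith
  qed
  define R where "R x = x - (\<Sum>e\<in>F. inner x e *\<^sub>R e)" for x
  have contR: "continuous_on UNIV R"
    unfolding R_def by (intro continuous_intros)
  have contT: "continuous_on UNIV T"
    by (simp add: linear_continuous_on bounded_linear_axioms)
  have "closed {x. inner (T (R x)) (R x) \<le> d * (norm x)\<^sup>2}"
    by (intro closed_Collect_le continuous_intros continuous_on_compose2[OF contT] contR) auto
  moreover have "span E \<subseteq> {x. inner (T (R x)) (R x) \<le> d * (norm x)\<^sup>2}"
  proof
    fix x assume "x \<in> span E"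
    then obtain H0 a0 where H0: "finite H0" "H0 \<subseteq> E" "x = (\<Sum>e\<in>H0. a0 e *\<^sub>R e)"
      by (auto simp: span_explicit)
    \<comment> \<open>Enlarging the support to contain F makes the remainder \<open>R x\<close> the
      part of the sum over H - F.\<close>
    define H where "H = H0 \<union> F"
    define a where "a e = (if e \<in> H0 then a0 e else 0)" for e
    have H: "finite H" "H \<subseteq> E" "F \<subseteq> H"
      using H0 F by (auto simp: H_def)
    have x: "x = (\<Sum>e\<in>H. a e *\<^sub>R e)"
      unfolding H0(3) using H
      by (intro sum.mono_neutral_cong_left) (auto simp: a_def H_def)
    have "inner x f = a f" if "f \<in> F" for f
    proof -
      have "inner x f = (\<Sum>e\<in>H. if e = f then a f else 0)"
        unfolding x inner_sum_left
      proof (intro sum.cong refl)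
        fix e assume "e \<in> H"
        show "inner (a e *\<^sub>R e) f = (if e = f then a f else 0)"
        proof (cases "e = f")
          case True
          then show ?thesis
            using E(2)[of f] F that by (auto simp: norm_eq_1)
        next
          case False
          then show ?thesis
            using E(1) H \<open>e \<in> H\<close> F that by (auto simp: pairwise_def orthogonal_def)
        qed
      qed
      then show ?thesis
        using H that by auto
    qed
    then have "R x = (\<Sum>e\<in>H. a e *\<^sub>R e) - (\<Sum>e\<in>F. a e *\<^sub>R e)"
      unfolding R_def by (subst x) simp
    then have Rx: "R x = (\<Sum>e\<in>H - F. a e *\<^sub>R e)"
      using H by (simp add: sum_diff)
    have on: "pairwise orthogonal (H - F)" "\<And>e. e \<in> H - F \<Longrightarrow> norm e = 1"
      "pairwise orthogonal H" "\<And>e. e \<in> H \<Longrightarrow> norm e = 1"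
      using E(2) H(2) pairwise_subset[OF E(1), of H] pairwise_subset[OF E(1), of "H - F"] by auto
    have "(norm (R x))\<^sup>2 = (\<Sum>e\<in>H - F. (a e)\<^sup>2)"
      unfolding Rx using H on by (intro orthonormal_sum_norm) auto
    also have "\<dots> \<le> (\<Sum>e\<in>H. (a e)\<^sup>2)"
      using H by (intro sum_mono2) auto
    also have "\<dots> = (norm x)\<^sup>2"
      unfolding x using H on by (intro orthonormal_sum_norm[symmetric]) auto
    finally have nle: "(norm (R x))\<^sup>2 \<le> (norm x)\<^sup>2" .
    have "inner (T (R x)) (R x) \<le> (\<Sum>e\<in>H - F. inner (T e) e) * (norm (R x))\<^sup>2"
      using H on Rx by (intro positive_operator_orthonormal_sum_le[OF T]) auto
    also have "\<dots> \<le> d * (norm x)\<^sup>2"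
      using H d nle by (intro mult_mono tail) auto
    finally show "x \<in> {x. inner (T (R x)) (R x) \<le> d * (norm x)\<^sup>2}" by simp
  qed
  ultimately have "closure (span E) \<subseteq> {x. inner (T (R x)) (R x) \<le> d * (norm x)\<^sup>2}"
    by (rule closure_minimal[rotated])
  then show ?thesis
    using that[of F] F E unfolding R_def Let_def by auto
qed

text \<open>The image of the unit ball is totally bounded: up to an error r / 4 it consists of
  images of projections onto the span of F, and these lie in the compact set of combinations with
  coefficients in [-1, 1].\<close>

lemma trace_class_compact:
  fixes T :: "'a::{real_inner,complete_space} \<Rightarrow> 'a"
  assumes T: "positive_operator T" and "trace_class T"
  shows "compact (closure (T ` cball 0 1))"
  unfolding compact_eq_totally_bounded
proof (intro conjI allI impI)
  interpret bounded_linear T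
    using T by (simp add: positive_operator_def)
  show "uniform_space_class.complete (closure (T ` cball 0 1))"
    by (simp add: complete_eq_closed)
  obtain K where K: "K > 0" "\<And>x. norm (T x) \<le> norm x * K"
    using pos_bounded by blast
  have nle: "(norm (T x))\<^sup>2 \<le> K * inner (T x) x" for x
  proof (rule positive_operator_norm_le[OF T])
    have "inner (T (T x)) (T x) \<le> norm (T (T x)) * norm (T x)"
      by (rule norm_cauchy_schwarz)
    also have "\<dots> \<le> norm (T x) * K * norm (T x)"
      by (intro mult_right_mono K) simp
    finally show "inner (T (T x)) (T x) \<le> K * (norm (T x))\<^sup>2"
      by (simp add: power2_eq_square mult_ac)
  qed
  fix r :: real assume r: "r > 0"
  \<comment> \<open>Chosen so that the form bound d becomes the norm bound r / 4 through
    \<open>nle\<close>.\<close>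
  define d where "d = (r / 4)\<^sup>2 / K"
  have d: "d > 0" "K * d = (r / 4)\<^sup>2"
    using r K by (auto simp: d_def)
  obtain F where F: "finite F" "\<And>e. e \<in> F \<Longrightarrow> norm e = 1"
    and tail: "\<And>x. let r = x - (\<Sum>e\<in>F. inner x e *\<^sub>R e) in inner (T r) r \<le> d * (norm x)\<^sup>2"
    using trace_class_tail[OF T assms(2) d(1)] by blast
  define A where "A = (\<lambda>a. \<Sum>e\<in>F. a e *\<^sub>R T e) ` {a. \<forall>e\<in>F. \<bar>a e\<bar> \<le> (1::real)}"
  have "compact A"
    unfolding A_def by (rule compact_bounded_coefficients) fact
  then obtain k where k: "finite k" "A \<subseteq> (\<Union>x\<in>k. ball x (r / 2))"
    unfolding compact_eq_totally_bounded using half_gt_zero[OF r] by blast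
  \<comment> \<open>Closed balls of radius 3/4 r = r/2 + r/4: their finite union is closed, hence
    covers the closure too, and the balls still fit into open balls of radius r.\<close>
  have "T ` cball 0 1 \<subseteq> (\<Union>x\<in>k. cball x (3 / 4 * r))"
  proof
    fix z assume "z \<in> T ` cball 0 1"
    then obtain x where x: "z = T x" "norm x \<le> 1"
      by auto
    define p where "p = (\<Sum>e\<in>F. inner x e *\<^sub>R e)"
    have "\<bar>inner x e\<bar> \<le> 1" if "e \<in> F" for e
      using Cauchy_Schwarz_ineq2[of x e] F(2)[OF that] x(2) by simp
    then have "T p \<in> A"
      unfolding A_def p_def sum scaleR by (intro imageI CollectI ballI)
    then have "T p \<in> (\<Union>x\<in>k. ball x (r / 2))"
      using k(2) by (rule subsetD[rotated])
    then obtain c where c: "c \<in> k" "dist c (T p) < r / 2"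
      by (auto simp del: Union_iff)
    have "(norm (T (x - p)))\<^sup>2 \<le> K * (d * (norm x)\<^sup>2)"
      using tail[of x] K(1) by (intro order_trans[OF nle[of "x - p"]] mult_left_mono) (simp_all add: Let_def p_def)
    also have "\<dots> = (r / 4)\<^sup>2 * (norm x)\<^sup>2"
      using d(2) by (simp only: mult.assoc[symmetric])
    also have "\<dots> \<le> (r / 4)\<^sup>2 * 1"
      using power_le_one[OF norm_ge_zero x(2)] by (rule mult_left_mono) simp
    finally have "norm (T (x - p)) \<le> r / 4"
      unfolding mult_1_right by (rule power2_le_imp_le) (use r in simp)
    then have "dist (T p) z \<le> r / 4"
      unfolding x(1) by (simp only: dist_norm diff norm_minus_commute[of "T p"])
    then have "dist c z \<le> 3 / 4 * r"
      using c(2) dist_triangle[of c z "T p"] by linarith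
    then show "z \<in> (\<Union>x\<in>k. cball x (3 / 4 * r))"
      using c(1) by auto
  qed
  moreover have "closed (\<Union>x\<in>k. cball x (3 / 4 * r))"
    using k(1) by (intro closed_UN) auto
  ultimately have "closure (T ` cball 0 1) \<subseteq> (\<Union>x\<in>k. cball x (3 / 4 * r))"
    by (rule closure_minimal)
  also have "\<dots> \<subseteq> (\<Union>x\<in>k. ball x r)"
    using r by (intro UN_mono) auto
  finally show "\<exists>k. finite k \<and> closure (T ` cball 0 1) \<subseteq> (\<Union>x\<in>k. ball x r)"
    using k(1) by blast
qed

text \<open>Let c be the supremum of <T x, x> on the unit sphere of V. Along a maximizing sequence
  |T x - c x|^2 <= c (c - <T x, x>) tends to 0, by \<open>positive_operator_norm_le\<close> with
  bound c. Compactness makes T x converge along a subsequence, hence also c x, and c > 0 by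
  injectivity.\<close>

lemma trace_class_eigenvector:
  fixes T :: "'a::{real_inner,complete_space} \<Rightarrow> 'a"
  assumes T: "positive_operator T" "trace_class T" "inj T"
    and V: "subspace V" "closed V" "\<And>x. x \<in> V \<Longrightarrow> T x \<in> V" "V \<noteq> {0}"
  obtains x c where "x \<in> V" "norm x = 1" "c > 0" "T x = c *\<^sub>R x"
proof -
  interpret bounded_linear T
    by (rule positive_operatorD(1)[OF T(1)])
  note nn = positive_operatorD(3)[OF T(1)]
  obtain K where K: "K > 0" "\<And>x. norm (T x) \<le> norm x * K"
    using pos_bounded by blast
  define A where "A = (\<lambda>x. inner (T x) x) ` {x\<in>V. norm x = 1}"
  define c where "c = Sup A"
  have bdd: "bdd_above A"
  proof (rule bdd_aboveI)
    fix a assume "a \<in> A"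
    then obtain x where "norm x = 1" "a = inner (T x) x"
      by (auto simp: A_def)
    then show "a \<le> K"
      using norm_cauchy_schwarz[of "T x" x] K(2)[of x] by simp
  qed
  obtain v where v: "v \<in> V" "v \<noteq> 0"
    using V(1,4) subspace_0 by blast
  define u where "u = v /\<^sub>R norm v"
  have u: "u \<in> V" "norm u = 1"
    using v V(1) by (auto simp: u_def subspace_scale)
  then have "A \<noteq> {}"
    by (auto simp: A_def)
  have "inner (T u) u \<noteq> 0"
  proof
    assume "inner (T u) u = 0"
    then have "T u = T 0"
      using positive_operator_inner_eq_0[OF T(1), of u] by (simp add: zero)
    then have "u = 0"
      by (rule injD[OF T(3)])
    then show False
      using u(2) by simp
  qed
  then have "0 < inner (T u) u"
    using nn[of u] by simp
  also have "\<dots> \<le> c"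
    unfolding c_def using u by (intro cSup_upper[OF _ bdd]) (auto simp: A_def)
  finally have c: "c > 0" .
  have le_c: "inner (T x) x \<le> c * (norm x)\<^sup>2" if "x \<in> V" for x
  proof (cases "x = 0")
    case False
    have "inner (T (x /\<^sub>R norm x)) (x /\<^sub>R norm x) \<le> c"
      unfolding c_def A_def using that False V(1)
      by (intro cSup_upper[OF _ bdd[unfolded A_def]] imageI CollectI) (simp add: subspace_scale)
    then have "inner (T x) x / (norm x)\<^sup>2 \<le> c"
      by (simp add: scaleR power2_eq_square divide_inverse mult_ac)
    then show ?thesis
      using False by (simp add: field_simps)
  qed (simp add: zero)
  have "\<exists>x. x \<in> V \<and> norm x = 1 \<and> c - 1 / Suc n < inner (T x) x" for n
  proof -
    have "c - 1 / Suc n < Sup A"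
      by (simp add: c_def)
    then obtain a where "a \<in> A" "c - 1 / Suc n < a"
      using less_cSup_iff[OF \<open>A \<noteq> {}\<close> bdd] by blast
    then show ?thesis
      by (auto simp: A_def)
  qed
  then obtain x where x: "\<And>n. x n \<in> V" "\<And>n. norm (x n) = 1" "\<And>n. c - 1 / Suc n < inner (T (x n)) (x n)"
    by metis
  have "T (x n) \<in> closure (T ` cball 0 1)" for n
    using x(2)[of n] by (intro subsetD[OF closure_subset] imageI) simp
  then obtain w r where r: "strict_mono r" "(\<lambda>n. T (x (r n))) \<longlonglongrightarrow> w"
    using seq_compactE[OF compact_imp_seq_compact[OF trace_class_compact[OF T(1,2)]], of "\<lambda>n. T (x n)"]
    unfolding comp_def by blast
  have close: "(norm (T (x n) - c *\<^sub>R x n))\<^sup>2 \<le> c * (1 / Suc n)" for n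
  proof -
    have "(norm (T (x n)))\<^sup>2 \<le> c * inner (T (x n)) (x n)"
      by (intro positive_operator_norm_le[OF T(1)] le_c V(3) x(1))
    moreover have "(norm (T (x n) - c *\<^sub>R x n))\<^sup>2 =
        (norm (T (x n)))\<^sup>2 - 2 * (c * inner (T (x n)) (x n)) + c * c"
      using x(2)[of n] unfolding power2_norm_eq_inner norm_eq_1
      by (simp add: inner_diff_left inner_diff_right inner_commute)
    moreover have "c * (c - 1 / Suc n) \<le> c * inner (T (x n)) (x n)"
      using c x(3)[of n] by (intro mult_left_mono) auto
    ultimately show ?thesis
      by (simp add: right_diff_distrib)
  qed
  have "(\<lambda>n. c * (1 / Suc n)) \<longlonglongrightarrow> c * 0"
    by (intro tendsto_mult tendsto_const LIMSEQ_Suc[OF lim_1_over_n])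
  then have lim0: "(\<lambda>n. c * (1 / Suc n)) \<longlonglongrightarrow> 0"
    by (simp only: mult_zero_right)
  have "(\<lambda>n. (norm (T (x n) - c *\<^sub>R x n))\<^sup>2) \<longlonglongrightarrow> 0"
  proof (rule Lim_null_comparison[OF _ lim0], rule always_eventually, rule allI)
    show "norm ((norm (T (x n) - c *\<^sub>R x n))\<^sup>2) \<le> c * (1 / Suc n)" for n
      using close[of n] by (simp only: real_norm_def abs_power2)
  qed
  then have "(\<lambda>n. sqrt ((norm (T (x n) - c *\<^sub>R x n))\<^sup>2)) \<longlonglongrightarrow> sqrt 0"
    by (rule tendsto_real_sqrt)
  then have "(\<lambda>n. norm (T (x n) - c *\<^sub>R x n)) \<longlonglongrightarrow> 0"
    by (simp only: real_sqrt_abs abs_norm_cancel real_sqrt_zero)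
  then have "(\<lambda>n. T (x n) - c *\<^sub>R x n) \<longlonglongrightarrow> 0"
    by (rule tendsto_norm_zero_cancel)
  then have "(\<lambda>n. T (x (r n)) - c *\<^sub>R x (r n)) \<longlonglongrightarrow> 0"
    using LIMSEQ_subseq_LIMSEQ[where X = "\<lambda>n. T (x n) - c *\<^sub>R x n", OF _ r(1)] by (simp only: comp_def)
  then have "(\<lambda>n. (1 / c) *\<^sub>R (T (x (r n)) - (T (x (r n)) - c *\<^sub>R x (r n)))) \<longlonglongrightarrow> (1 / c) *\<^sub>R (w - 0)"
    using \<open>(\<lambda>n. T (x (r n)) - c *\<^sub>R x (r n)) \<longlonglongrightarrow> 0\<close>
    by (intro tendsto_scaleR[OF tendsto_const] tendsto_diff[OF r(2)])
  then have lim: "(\<lambda>n. x (r n)) \<longlonglongrightarrow> (1 / c) *\<^sub>R w"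
    using c by simp
  define z where "z = (1 / c) *\<^sub>R w"
  have "z \<in> V"
    using closed_sequentially[OF V(2), of "\<lambda>n. x (r n)"] x(1) lim by (simp add: z_def)
  moreover have "norm z = 1"
    using tendsto_norm[OF lim] unfolding x(2) LIMSEQ_const_iff z_def by (rule sym)
  moreover have "T z = c *\<^sub>R z"
  proof -
    have "(\<lambda>n. T (x (r n))) \<longlonglongrightarrow> T z"
      unfolding z_def by (rule tendsto[OF lim])
    then have "T z = w"
      using r(2) by (rule LIMSEQ_unique)
    then show ?thesis
      using c by (simp add: z_def)
  qed
  ultimately show thesis
    using that c by blast
qed

section \<open>Maximal orthonormal families of eigenvectors\<close>

lemma countable_orthonormal:
  fixes M :: "'a::{real_inner,second_countable_topology} set"
  assumes "pairwise orthogonal M" "\<And>e. e \<in> M \<Longrightarrow> norm e = 1"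
  shows "countable M"
proof -
  have far: "dist e f \<ge> 1" if "e \<in> M" "f \<in> M" "e \<noteq> f" for e f
  proof -
    have "inner e f = 0" "inner e e = 1" "inner f f = 1"
      using assms that by (auto simp: pairwise_def orthogonal_def norm_eq_1[symmetric])
    then have "(dist e f)\<^sup>2 = 2"
      unfolding dist_norm power2_norm_eq_inner by (simp add: inner_diff_left inner_diff_right inner_commute)
    then show ?thesis
      by (intro power2_le_imp_le[of 1]) auto
  qed
  have disj: "ball e (1 / 2) \<inter> ball f (1 / 2) = {}" if "e \<in> M" "f \<in> M" "e \<noteq> f" for e f
  proof (rule ccontr)
    assume "ball e (1 / 2) \<inter> ball f (1 / 2) \<noteq> {}"
    then obtain y where "dist e y < 1 / 2" "dist f y < 1 / 2"
      by auto
    then show False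
      using far[OF that] dist_triangle2[of e f y] by simp
  qed
  \<comment> \<open>Distinct members are at least 1 apart, so the balls of radius 1/2 form a
    disjoint family of open sets.\<close>
  have "countable ((\<lambda>e. ball e (1 / 2)) ` M)"
  proof (rule countable_disjoint_open_subsets)
    show "disjoint ((\<lambda>e. ball e (1 / 2)) ` M)"
      unfolding pairwise_def disjnt_def using disj by auto
  qed auto
  moreover have "inj_on (\<lambda>e. ball e (1 / 2)) M"
  proof (rule inj_onI, rule ccontr)
    fix e f assume ef: "e \<in> M" "f \<in> M" "ball e (1 / 2) = ball f (1 / 2)" "e \<noteq> f"
    have "e \<in> ball e (1 / 2)" by simp
    then show False
      using disj[OF ef(1,2,4)] ef(3) by auto
  qed
  ultimately show ?thesis
    by (rule countable_image_inj_on)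
qed

text \<open>Zorn's lemma gives a maximal orthonormal set of eigenvectors. By symmetry of C its
  orthogonal complement is invariant; were it nontrivial, it would contain another
  eigenvector.\<close>

lemma eigenbasis_exists:
  fixes C :: "'a::{real_inner,polish_space} \<Rightarrow> 'a"
  assumes C: "positive_operator C" "trace_class C" "inj C"
  obtains e l where "eigenbasis e C l"
proof -
  interpret bounded_linear C
    by (rule positive_operatorD(1)[OF C(1)])
  define P where "P M \<longleftrightarrow> pairwise orthogonal M \<and> (\<forall>e\<in>M. norm e = 1 \<and> (\<exists>c>0. C e = c *\<^sub>R e))" for M
  have "\<exists>M\<in>{M. P M}. \<forall>X\<in>{M. P M}. M \<subseteq> X \<longrightarrow> X = M"
  proof (rule subset_Zorn')
    fix \<C> assume ch: "subset.chain {M. P M} \<C>"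
    then have "\<forall>M\<in>\<C>. P M"
      by (auto simp: subset_chain_def)
    moreover have "pairwise orthogonal (\<Union>\<C>)"
      using ch \<open>\<forall>M\<in>\<C>. P M\<close> unfolding P_def subset_chain_def
      by (intro pairwise_chain_Union) (auto simp: chain_subset_def)
    ultimately show "\<Union>\<C> \<in> {M. P M}"
      unfolding P_def by auto
  qed
  then obtain M where M: "P M" and max: "\<And>X. P X \<Longrightarrow> M \<subseteq> X \<Longrightarrow> X = M"
    by blast
  define V where "V = {x. \<forall>m\<in>M. inner x m = 0}"
  have V0: "V = {0}"
  proof (rule ccontr)
    assume "V \<noteq> {0}"
    moreover have "subspace V"
      unfolding V_def subspace_def by (auto simp: inner_add_left)
    moreover have "closed V"
    proof -
      have "V = (\<Inter>m\<in>M. {x. inner x m = 0})"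
        by (auto simp: V_def)
      then show ?thesis
        by (auto intro!: closed_INT closed_Collect_eq continuous_intros)
    qed
    moreover have "C x \<in> V" if "x \<in> V" for x
      unfolding V_def
    proof (intro CollectI ballI)
      fix m assume m: "m \<in> M"
      then obtain c where "C m = c *\<^sub>R m"
        using M by (auto simp: P_def)
      then show "inner (C x) m = 0"
        using that m positive_operatorD(2)[OF C(1), of x m] by (simp add: V_def)
    qed
    ultimately obtain x c where x: "x \<in> V" "norm x = 1" "c > 0" "C x = c *\<^sub>R x"
      using trace_class_eigenvector[OF C] by metis
    have "P (insert x M)"
      using M x unfolding P_def V_def pairwise_insert by (auto simp: orthogonal_def inner_commute)
    then have "x \<in> M"
      using max by blast
    then show False
      using x(1,2) by (auto simp: V_def)
  qed
  have "countable M"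
    using M by (intro countable_orthonormal) (auto simp: P_def)
  then obtain f :: "'a \<Rightarrow> nat" where f: "inj_on f M"
    by (auto simp: countable_def)
  \<comment> \<open>Indices that enumerate no member of M receive the zero vector; below, their
    eigenvalue may be taken to be 1.\<close>
  define e where "e n = (if n \<in> f ` M then inv_into M f n else 0)" for n
  have e: "e n \<in> M \<or> e n = 0" for n
    by (auto simp: e_def inv_into_into)
  have ef: "e (f m) = m" if "m \<in> M" for m
    using that f by (simp add: e_def)
  have inj: "i = j" if "e i = e j" "e i \<in> M" for i j
  proof -
    have "0 \<notin> M"
      using M by (auto simp: P_def)
    then have "i \<in> f ` M" "j \<in> f ` M"
      using that by (auto simp: e_def split: if_splits)
    then show ?thesis
      using that by (metis e_def f_inv_into_f)
  qed
  have "\<exists>c>0. C (e n) = c *\<^sub>R e n" for n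
    using M e[of n] by (auto simp: P_def zero intro: exI[of _ 1])
  then obtain l where l: "\<And>n. l n > 0" "\<And>n. C (e n) = l n *\<^sub>R e n"
    by metis
  have "eigenbasis e C l"
  proof
    fix i j :: nat assume "i \<noteq> j"
    then show "inner (e i) (e j) = 0"
      using e[of i] e[of j] inj[of i j] M by (auto simp: P_def pairwise_def orthogonal_def)
  next
    show "e i = 0 \<or> norm (e i) = 1" for i
      using e[of i] M by (auto simp: P_def)
  next
    fix x assume *: "\<And>i. inner x (e i) = 0"
    have "x \<in> V"
      unfolding V_def
    proof (intro CollectI ballI)
      fix m assume "m \<in> M"
      then show "inner x m = 0"
        using *[of "f m"] ef by simp
    qed
    then show "x = 0"
      using V0 by simp
  qed (use C l in auto)
  then show thesis
    by (rule that)
qed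

section \<open>Cameron-Martin formula and reflections\<close>

lemma nn_integral_exp_normal:
  assumes "\<sigma> > 0"
  shows "(\<integral>\<^sup>+s. exp s \<partial>density lborel (normal_density 0 \<sigma>)) = exp (\<sigma>\<^sup>2 / 2)"
proof -
  have "exp s * normal_density 0 \<sigma> s = exp (\<sigma>\<^sup>2 / 2) * normal_density (\<sigma>\<^sup>2) \<sigma> s" for s
  proof -
    have "s - s\<^sup>2 / (2 * \<sigma>\<^sup>2) = \<sigma>\<^sup>2 / 2 - (s - \<sigma>\<^sup>2)\<^sup>2 / (2 * \<sigma>\<^sup>2)"
      using assms by (simp add: field_simps power2_eq_square)
    then have "exp s * exp (- s\<^sup>2 / (2 * \<sigma>\<^sup>2)) = exp (\<sigma>\<^sup>2 / 2) * exp (- (s - \<sigma>\<^sup>2)\<^sup>2 / (2 * \<sigma>\<^sup>2))"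
      by (simp flip: exp_add)
    then show ?thesis
      by (simp add: normal_density_def mult_ac)
  qed
  then have "(\<integral>\<^sup>+s. exp s \<partial>density lborel (normal_density 0 \<sigma>)) =
      (\<integral>\<^sup>+s. ennreal (exp (\<sigma>\<^sup>2 / 2)) * ennreal (normal_density (\<sigma>\<^sup>2) \<sigma> s) \<partial>lborel)"
    by (subst nn_integral_density) (simp_all add: mult.commute flip: ennreal_mult')
  also have "\<dots> = ennreal (exp (\<sigma>\<^sup>2 / 2)) * emeasure (density lborel (normal_density (\<sigma>\<^sup>2) \<sigma>)) UNIV"
    by (simp add: nn_integral_cmult emeasure_density)
  also have "emeasure (density lborel (normal_density (\<sigma>\<^sup>2) \<sigma>)) UNIV = 1"
    using prob_space.emeasure_space_1[OF prob_space_normal_density[OF assms, of "\<sigma>\<^sup>2"]] by simp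
  finally show ?thesis by simp
qed

text \<open>Continuity from below. It turns an estimate with an arbitrarily small loss in the radius
  into one without loss, and thereby absorbs the errors of truncation to finitely many
  coordinates.\<close>

lemma emeasure_ball_le:
  fixes z :: "'a::real_normed_vector"
  assumes M: "sets M = sets borel" and "\<And>s. s < r \<Longrightarrow> emeasure M (ball z s) \<le> c"
  shows "emeasure M (ball z r) \<le> c"
proof -
  define A where "A n = ball z (r - 1 / Suc n)" for n
  have "incseq A"
    unfolding A_def by (intro incseq_SucI subset_ball) (simp add: frac_le)
  moreover have "range A \<subseteq> sets M"
    unfolding A_def M by auto
  ultimately have "(SUP n. emeasure M (A n)) = emeasure M (\<Union>n. A n)"
    by (intro SUP_emeasure_incseq)
  moreover have "(\<Union>n. A n) = ball z r"
  proof (intro set_eqI iffI)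
    fix x assume "x \<in> ball z r"
    then have "0 < r - dist z x"
      by simp
    then obtain n where "1 / Suc n < r - dist z x"
      by (metis nat_approx_posE)
    then show "x \<in> (\<Union>n. A n)"
      unfolding A_def by (auto intro!: exI[of _ n])
  next
    fix x assume "x \<in> (\<Union>n. A n)"
    then obtain n where "dist z x < r - 1 / Suc n"
      by (auto simp: A_def)
    moreover have "0 < 1 / real (Suc n)" by simp
    ultimately show "x \<in> ball z r"
      unfolding mem_ball by linarith
  qed
  moreover have "(SUP n. emeasure M (A n)) \<le> c"
    unfolding A_def by (intro SUP_least assms(2)) simp
  ultimately show ?thesis by simp
qed

locale gaussian =
  fixes \<mu> :: "'a::{real_inner,polish_space} measure" and C :: "'a \<Rightarrow> 'a"
  assumes gaussian: "nondegenerate_centered_gaussian \<mu> C"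
begin

lemma sets_eq [measurable_cong, simp]: "sets \<mu> = sets borel"
  using gaussian by (simp add: nondegenerate_centered_gaussian_def gaussian_measure_def)

lemma space_eq [simp]: "space \<mu> = UNIV"
  using sets_eq_imp_space_eq[OF sets_eq] by simp

sublocale prob_space \<mu>
  using gaussian by (simp add: nondegenerate_centered_gaussian_def gaussian_measure_def)

lemma positive_C: "positive_operator C" and trace_class_C: "trace_class C" and inj_C: "inj C"
  using gaussian by (auto simp: nondegenerate_centered_gaussian_def covariance_operator_def)

lemma bounded_linear_C: "bounded_linear C"
  by (rule positive_operatorD[OF positive_C])

lemma C_sym: "inner (C x) y = inner x (C y)"
  by (rule positive_operatorD[OF positive_C])

lemma mean_zero: "(\<integral>x. inner x k \<partial>\<mu>) = 0"
  using gaussian by (simp add: nondegenerate_centered_gaussian_def centered_def)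

lemma variance_C: "inner (C k) k = (\<integral>x. (inner x k)\<^sup>2 \<partial>\<mu>)"
  using gaussian mean_zero
  by (simp add: nondegenerate_centered_gaussian_def covariance_operator_def power2_eq_square)

lemma laplace: "(\<integral>\<^sup>+x. exp (inner x k) \<partial>\<mu>) = exp (inner (C k) k / 2)"
proof -
  define X where "X x = inner x k" for x
  have [measurable]: "X \<in> borel_measurable borel"
    unfolding X_def by measurable
  have "(\<integral>\<^sup>+s. exp s \<partial>distr \<mu> borel X) = exp (inner (C k) k / 2)"
  proof -
    have "gaussian_real (distr \<mu> borel X)"
      using gaussian unfolding X_def
      by (simp add: nondegenerate_centered_gaussian_def gaussian_measure_def)
    then consider m where "distr \<mu> borel X = return borel m"
      | m \<sigma> where "\<sigma> > 0" "distr \<mu> borel X = density lborel (normal_density m \<sigma>)"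
      unfolding gaussian_real_def by blast
    then show ?thesis
    proof cases
      \<comment> \<open>This is the case k = 0: the projection is constant and both sides equal
        1.\<close>
      case (1 m)
      have "(\<integral>x. X x \<partial>\<mu>) = (\<integral>s. s \<partial>distr \<mu> borel X)"
        by (subst integral_distr) simp_all
      then have "m = 0"
        using mean_zero[of k] unfolding 1 by (simp add: X_def integral_return)
      have "(\<integral>x. (X x)\<^sup>2 \<partial>\<mu>) = (\<integral>s. s\<^sup>2 \<partial>distr \<mu> borel X)"
        by (subst integral_distr) simp_all
      then have "inner (C k) k = 0"
        unfolding 1 \<open>m = 0\<close> variance_C by (simp add: X_def integral_return)
      then show ?thesis
        unfolding 1 \<open>m = 0\<close> by (simp add: nn_integral_return)
    next
      case (2 m \<sigma>)
      have "distr \<mu> lborel X = distr \<mu> borel X"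
        by (rule distr_cong) simp_all
      then have D: "distributed \<mu> lborel X (\<lambda>s. ennreal (normal_density m \<sigma> s))"
        unfolding distributed_def 2 by simp
      have "m = 0"
        using normal_distributed_expectation[OF 2(1) D] mean_zero[of k] by (simp add: X_def[abs_def])
      have "inner (C k) k = \<sigma>\<^sup>2"
        using normal_distributed_variance[OF 2(1) D] mean_zero[of k]
        unfolding variance_C by (simp add: X_def[abs_def])
      then show ?thesis
        unfolding 2 \<open>m = 0\<close> using nn_integral_exp_normal[OF 2(1)] by simp
    qed
  qed
  moreover have "(\<integral>\<^sup>+s. exp s \<partial>distr \<mu> borel X) = (\<integral>\<^sup>+x. exp (X x) \<partial>\<mu>)"
    by (subst nn_integral_distr) simp_all
  ultimately show ?thesis
    by (simp add: X_def)
qed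

text \<open>Both measures have the Laplace transform exp (<C w, k> + 1/2 <C k, k>) at k.\<close>

lemma cameron_martin:
  "distr \<mu> borel (\<lambda>x. x + C w) = density \<mu> (\<lambda>x. exp (inner x w - inner (C w) w / 2))"
proof (rule measure_eqI_exp_inner)
  interpret C: bounded_linear C
    by (rule bounded_linear_C)
  fix k
  have "(\<integral>\<^sup>+x. exp (inner x k) \<partial>distr \<mu> borel (\<lambda>x. x + C w)) =
      (\<integral>\<^sup>+x. ennreal (exp (inner (C w) k)) * ennreal (exp (inner x k)) \<partial>\<mu>)"
    by (subst nn_integral_distr) (simp_all add: inner_add_left add.commute exp_add ennreal_mult mult.commute)
  also have "\<dots> = ennreal (exp (inner (C w) k)) * ennreal (exp (inner (C k) k / 2))"
    by (subst nn_integral_cmult) (simp_all add: laplace)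
  also have "\<dots> = exp (inner (C w) k + inner (C k) k / 2)"
    by (simp add: exp_add ennreal_mult)
  finally have l: "(\<integral>\<^sup>+x. exp (inner x k) \<partial>distr \<mu> borel (\<lambda>x. x + C w)) =
      exp (inner (C w) k + inner (C k) k / 2)" .
  have "(\<integral>\<^sup>+x. exp (inner x k) \<partial>density \<mu> (\<lambda>x. exp (inner x w - inner (C w) w / 2))) =
      (\<integral>\<^sup>+x. ennreal (exp (- inner (C w) w / 2)) * ennreal (exp (inner x (k + w))) \<partial>\<mu>)"
    by (subst nn_integral_density)
      (simp_all add: inner_add_right add_divide_distrib algebra_simps flip: ennreal_mult exp_add)
  also have "\<dots> = ennreal (exp (- inner (C w) w / 2)) * ennreal (exp (inner (C (k + w)) (k + w) / 2))"
    by (subst nn_integral_cmult) (simp_all add: laplace)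
  also have "\<dots> = exp (- inner (C w) w / 2 + inner (C (k + w)) (k + w) / 2)"
    by (simp only: exp_add ennreal_mult[OF exp_ge_zero exp_ge_zero])
  also have "- inner (C w) w / 2 + inner (C (k + w)) (k + w) / 2 = inner (C w) k + inner (C k) k / 2"
    using C_sym[of k w] by (simp add: C.add inner_add_left inner_add_right inner_commute add_divide_distrib)
  finally show "(\<integral>\<^sup>+x. exp (inner x k) \<partial>distr \<mu> borel (\<lambda>x. x + C w)) =
      (\<integral>\<^sup>+x. exp (inner x k) \<partial>density \<mu> (\<lambda>x. exp (inner x w - inner (C w) w / 2)))"
    unfolding l by simp
  show "(\<integral>\<^sup>+x. exp (inner x k) \<partial>distr \<mu> borel (\<lambda>x. x + C w)) < \<infinity>"
    unfolding l by simp
qed simp_all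

text \<open>The Laplace transform of the image at k is that of \<mu> at U k. Applied to x -> -x and
  to reflections in hyperplanes orthogonal to an eigenvector.\<close>

lemma distr_invariant:
  assumes [measurable]: "U \<in> borel_measurable borel"
    and sym: "\<And>x k. inner (U x) k = inner x (U k)"
    and inv: "\<And>k. inner (C (U k)) (U k) = inner (C k) k"
  shows "distr \<mu> borel U = \<mu>"
proof (rule measure_eqI_exp_inner)
  fix k
  have l: "(\<integral>\<^sup>+x. exp (inner x k) \<partial>distr \<mu> borel U) = exp (inner (C k) k / 2)"
    using laplace[of "U k"] by (subst nn_integral_distr) (simp_all add: sym inv)
  show "(\<integral>\<^sup>+x. exp (inner x k) \<partial>distr \<mu> borel U) = (\<integral>\<^sup>+x. exp (inner x k) \<partial>\<mu>)"
    unfolding l laplace ..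
  show "(\<integral>\<^sup>+x. exp (inner x k) \<partial>distr \<mu> borel U) < \<infinity>"
    unfolding l by simp
qed simp_all

lemma emeasure_uminus_ball: "emeasure \<mu> (ball (- z) r) = emeasure \<mu> (ball z r)"
proof -
  interpret C: bounded_linear C
    by (rule bounded_linear_C)
  have "emeasure \<mu> (ball z r) = emeasure (distr \<mu> borel uminus) (ball z r)"
    by (subst distr_invariant) (simp_all add: C.neg)
  also have "\<dots> = emeasure \<mu> (uminus -` ball z r)"
    by (subst emeasure_distr) simp_all
  also have "uminus -` ball z r = ball (- z) r"
    by (auto simp: dist_norm) (metis add.commute diff_minus_eq_add minus_diff_eq norm_minus_cancel)+
  finally show ?thesis ..
qed

lemma emeasure_shifted_ball:
  "emeasure \<mu> (ball (z - C w) r) =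
    (\<integral>\<^sup>+x. ennreal (exp (inner x w - inner (C w) w / 2)) * indicator (ball z r) x \<partial>\<mu>)"
proof -
  have "emeasure \<mu> (ball (z - C w) r) = emeasure (distr \<mu> borel (\<lambda>x. x + C w)) (ball z r)"
    by (subst emeasure_distr) (simp_all add: vimage_def ball_def dist_norm diff_diff_eq add.commute)
  then show ?thesis
    unfolding cameron_martin by (simp add: emeasure_density)
qed

text \<open>A translation by \<open>a\<close> along an eigenvector is a composition of two reflections; the reflection
  in the hyperplane \<open>{x. inner x e = a / 2}\<close> swaps the two balls, and its Cameron-Martin density is
  at least one on the half space containing \<open>z\<close>.\<close>
lemma emeasure_ball_remove_coordinate_pos:
  assumes e: "norm e = 1" "C e = l *\<^sub>R e" "l > 0" and a: "a = inner z e" "a > 0"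
  shows "emeasure \<mu> (ball z r) \<le> emeasure \<mu> (ball (z - a *\<^sub>R e) r)"
proof -
  interpret C: bounded_linear C
    by (rule bounded_linear_C)
  have ee: "inner e e = 1"
    using e(1) by (simp add: norm_eq_1)
  define U where "U x = x - (2 * inner x e) *\<^sub>R e" for x
  \<comment> \<open>With C w = a e, the reflection U through the origin followed by the shift C w is
    the reflection that swaps the two balls.\<close>
  define w where "w = (a / l) *\<^sub>R e"
  have Cw: "C w = a *\<^sub>R e"
    using e by (simp add: w_def C.scaleR)
  have [measurable]: "U \<in> borel_measurable borel"
    unfolding U_def by measurable
  have U: "distr \<mu> borel U = \<mu>"
  proof (rule distr_invariant)
    show "inner (U x) k = inner x (U k)" for x k
      by (simp add: U_def inner_diff_left inner_diff_right inner_commute)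
    show "inner (C (U k)) (U k) = inner (C k) k" for k
      using C_sym[of k e] ee
      by (simp add: U_def C.diff C.scaleR e(2) inner_diff_left inner_diff_right inner_commute algebra_simps)
  qed simp
  have normU: "norm (U x) = norm x" for x
    by (simp add: norm_eq_sqrt_inner U_def inner_diff_left inner_diff_right ee inner_commute algebra_simps)
  define A where "A = ball z r"
  define B where "B = ball (z - a *\<^sub>R e) r"
  have [measurable]: "A \<in> sets borel" "B \<in> sets borel"
    by (auto simp: A_def B_def)
  have pre: "(\<lambda>x. U x + C w) -` (A - B) = B - A"
  proof -
    have "U x + C w - z = U (x - (z - a *\<^sub>R e))" for x
      using a ee by (simp add: U_def Cw inner_diff_left algebra_simps)
    then have 1: "dist z (U x + C w) = dist (z - a *\<^sub>R e) x" for x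
      by (metis dist_commute dist_norm normU)
    have "U x + C w - (z - a *\<^sub>R e) = U (x - z)" for x
      using a ee by (simp add: U_def Cw inner_diff_left algebra_simps) (simp only: mult_2_right scaleR_add_left)
    then have 2: "dist (z - a *\<^sub>R e) (U x + C w) = dist z x" for x
      by (metis dist_commute dist_norm normU)
    show ?thesis
      unfolding A_def B_def using 1 2 by auto
  qed
  have "distr \<mu> borel (\<lambda>x. U x + C w) = distr (distr \<mu> borel U) borel (\<lambda>x. x + C w)"
    by (subst distr_distr) (simp_all add: comp_def)
  also have "\<dots> = density \<mu> (\<lambda>x. exp (inner x w - inner (C w) w / 2))"
    unfolding U by (rule cameron_martin)
  finally have refl: "distr \<mu> borel (\<lambda>x. U x + C w) = density \<mu> (\<lambda>x. exp (inner x w - inner (C w) w / 2))" .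
  have "emeasure \<mu> (A - B) = (\<integral>\<^sup>+x. indicator (A - B) x \<partial>\<mu>)"
    by simp
  also have "\<dots> \<le> (\<integral>\<^sup>+x. ennreal (exp (inner x w - inner (C w) w / 2)) * indicator (A - B) x \<partial>\<mu>)"
  proof (intro nn_integral_mono)
    fix x
    show "indicator (A - B) x \<le> ennreal (exp (inner x w - inner (C w) w / 2)) * indicator (A - B) x"
    proof (cases "x \<in> A - B")
      case True
      \<comment> \<open>A point of A - B is nearer to z than to z - a e. Comparing squared distances
        puts <x, e> above a / 2, where the exponent (a / l) (<x, e> - a / 2) is nonnegative.\<close>
      then have "dist z x < dist (z - a *\<^sub>R e) x"
        by (auto simp: A_def B_def)
      then have "(norm (x - z))\<^sup>2 < (norm (x - z + a *\<^sub>R e))\<^sup>2"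
        by (intro power_strict_mono) (auto simp: dist_norm norm_minus_commute algebra_simps)
      then have "0 < a * (2 * inner (x - z) e + a)"
        unfolding power2_norm_eq_inner
        by (simp add: inner_add_left inner_add_right inner_commute ee algebra_simps)
      then have "0 < 2 * inner (x - z) e + a"
        using a(2) by (simp add: zero_less_mult_iff)
      then have "a / 2 \<le> inner x e"
        using a(1) by (simp add: inner_diff_left)
      then have "(a / l) * (a / 2) \<le> (a / l) * inner x e"
        using a(2) e(3) by (intro mult_left_mono) auto
      then have "inner (C w) w / 2 \<le> inner x w"
        unfolding Cw by (simp add: w_def ee)
      then have "1 \<le> exp (inner x w - inner (C w) w / 2)"
        by simp
      then show ?thesis
        using True by simp
    qed simp
  qed
  also have "\<dots> = emeasure (distr \<mu> borel (\<lambda>x. U x + C w)) (A - B)"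
    unfolding refl by (simp add: emeasure_density)
  also have "\<dots> = emeasure \<mu> (B - A)"
    by (subst emeasure_distr) (simp_all add: pre)
  finally have le: "emeasure \<mu> (A - B) \<le> emeasure \<mu> (B - A)" .
  have "emeasure \<mu> A = emeasure \<mu> (A \<inter> B) + emeasure \<mu> (A - B)"
    by (subst plus_emeasure) (auto intro: arg_cong[where f = "emeasure \<mu>"])
  also have "\<dots> \<le> emeasure \<mu> (A \<inter> B) + emeasure \<mu> (B - A)"
    using le by (intro add_left_mono)
  also have "\<dots> = emeasure \<mu> B"
    by (subst plus_emeasure) (auto intro: arg_cong[where f = "emeasure \<mu>"])
  finally show ?thesis
    by (simp add: A_def B_def)
qed

lemma emeasure_ball_remove_coordinate:
  assumes "norm e = 1" "C e = l *\<^sub>R e" "l > 0"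
  shows "emeasure \<mu> (ball z r) \<le> emeasure \<mu> (ball (z - inner z e *\<^sub>R e) r)"
proof -
  interpret C: bounded_linear C
    by (rule bounded_linear_C)
  consider "inner z e = 0" | "inner z e > 0" | "inner z (- e) > 0"
    by fastforce
  then show ?thesis
  proof cases
    case 2
    then show ?thesis
      using emeasure_ball_remove_coordinate_pos[OF assms refl] by simp
  next
    case 3
    then show ?thesis
      using emeasure_ball_remove_coordinate_pos[of "- e" l "inner z (- e)" z] assms
      by (simp add: C.neg)
  qed simp
qed

end

section \<open>Small ball estimates\<close>

context eigenbasis
begin

text \<open>Diagonal operators of finite rank. Cutting off after n coordinates makes the inverses of
  C and S available, although the full inverses may be unbounded.\<close>

definition multiplier :: "nat \<Rightarrow> (nat \<Rightarrow> real) \<Rightarrow> 'a \<Rightarrow> 'a" where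
  "multiplier n t x = (\<Sum>i<n. (t i * inner x (e i)) *\<^sub>R e i)"

lemma inner_multiplier: "inner (multiplier n t x) y = (\<Sum>i<n. t i * inner x (e i) * inner y (e i))"
  unfolding multiplier_def inner_sum_left by (simp add: inner_commute)

lemma inner_multiplier_e: "inner (multiplier n t x) (e j) = (if j < n then t j * inner x (e j) else 0)"
  unfolding multiplier_def inner_sum_e[OF finite_lessThan] by (simp add: mult.assoc inner_e_cancel)

lemma inner_multiplier2:
  "inner (multiplier n t x) (multiplier n s y) = (\<Sum>i<n. t i * s i * inner x (e i) * inner y (e i))"
  unfolding inner_multiplier[of n t x] by (intro sum.cong refl) (simp add: inner_multiplier_e)

lemma C_multiplier: "C (multiplier n t x) = multiplier n (\<lambda>i. l i * t i) x"
  by (rule inner_eqI) (simp add: inner_C_e inner_multiplier_e)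

lemma S_multiplier: "S (multiplier n t x) = multiplier n (\<lambda>i. sqrt (l i) * t i) x"
  by (rule inner_eqI) (simp add: inner_S_e inner_multiplier_e)

lemma multiplier_tendsto: "(\<lambda>n. multiplier n (\<lambda>_. 1) x) \<longlonglongrightarrow> x"
  using expansion[of x] by (simp add: sums_def multiplier_def)

lemma multiplier_add: "multiplier n t x + multiplier n s x = multiplier n (\<lambda>i. t i + s i) x"
  by (rule inner_eqI) (simp add: inner_add_left inner_multiplier_e algebra_simps)

lemma multiplier_scaleR: "c *\<^sub>R multiplier n t x = multiplier n (\<lambda>i. c * t i) x"
  by (rule inner_eqI) (simp add: inner_multiplier_e)

lemma norm_multiplier: "(norm (multiplier n t x))\<^sup>2 = (\<Sum>i<n. (t i)\<^sup>2 * (inner x (e i))\<^sup>2)"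
  unfolding power2_norm_eq_inner inner_multiplier2 by (simp add: power2_eq_square mult_ac)

lemma norm_multiplier_one_le: "norm (multiplier n (\<lambda>_. 1) x) \<le> norm x"
proof (rule power2_le_imp_le)
  show "(norm (multiplier n (\<lambda>_. 1) x))\<^sup>2 \<le> (norm x)\<^sup>2"
    unfolding norm_multiplier using bessel by simp
qed simp

text \<open>The Fenchel conjugate of \<open>w \<mapsto> inner (C w) w / 2\<close> is half the squared
  Cameron-Martin norm, with value infinity outside the range of \<open>S\<close>.\<close>
lemma range_S_I:
  assumes K: "\<And>w. inner w x - inner (C w) w / 2 \<le> K"
  obtains v where "x = S v" "(norm v)\<^sup>2 / 2 \<le> K"
proof -
  define a where "a i = inner x (e i) / sqrt (l i)" for i
  have a2: "(a i)\<^sup>2 = inverse (l i) * (inner x (e i))\<^sup>2" for i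
    using l_pos[of i] by (simp add: a_def power_divide divide_inverse power_mult_distrib power_inverse mult.commute less_imp_le)
  have bound: "(\<Sum>i<n. (a i)\<^sup>2) \<le> 2 * K" for n
  proof -
    \<comment> \<open>The inverse of C applied to the truncation of x; it maximizes the left side of
      K over the span of the first n vectors.\<close>
    define w where "w = multiplier n (\<lambda>i. inverse (l i)) x"
    have "inner w x = (\<Sum>i<n. (a i)\<^sup>2)"
      unfolding w_def inner_multiplier a2 by (simp add: power2_eq_square mult.assoc)
    moreover have "inner (C w) w = (\<Sum>i<n. (a i)\<^sup>2)"
      unfolding w_def C_multiplier inner_multiplier2 a2
      using l_pos by (intro sum.cong refl) (simp add: power2_eq_square mult.assoc less_imp_neq[symmetric])
    ultimately show ?thesis
      using K[of w] by simp
  qed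
  then have sm: "summable (\<lambda>i. (a i)\<^sup>2)"
    by (intro summableI_nonneg_bounded) auto
  define v where "v = (\<Sum>i. a i *\<^sub>R e i)"
  have v: "inner v (e i) = a i" for i
    unfolding v_def inner_suminf_e_same[OF sm] by (simp add: a_def inner_e_cancel)
  have "S v = x"
    by (rule inner_eqI) (use l_pos in \<open>simp add: inner_S_e v a_def less_imp_neq[symmetric]\<close>)
  moreover have "(norm v)\<^sup>2 \<le> 2 * K"
    using parseval_norm[of v] bound unfolding v by (metis sums_iff suminf_le_const)
  ultimately show thesis
    by (intro that[of v]) auto
qed

text \<open>Tikhonov regularization: \<open>w\<close> solves \<open>C w + \<alpha> w = z\<close> up to truncation of \<open>z\<close>, with \<open>\<alpha>\<close> chosen by
  the discrepancy principle. The parameter \<open>\<theta> = \<alpha> / (1 + \<alpha>)\<close> runs through a compact interval.\<close>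
lemma tikhonov:
  assumes r: "r > 0" and z: "norm z > 2 * r"
  obtains w where "norm (C w - z) \<le> 2 * r"
    and "inner (C w) w / 2 - inner w z + r * norm w = - (norm (S w))\<^sup>2 / 2"
proof -
  obtain n where n: "norm (multiplier n (\<lambda>_. 1) z - z) < r"
    using LIMSEQ_D[OF multiplier_tendsto r] by blast
  define p where "p = multiplier n (\<lambda>_. 1) z"
  \<comment> \<open>Truncation costs less than r, so |z| > 2 r leaves room for a residual of norm
    exactly r.\<close>
  have p: "norm p > r"
    using n z norm_triangle_ineq2[of z p] by (simp add: p_def norm_minus_commute)
  \<comment> \<open>Since \<alpha> / (l i + \<alpha>) = \<theta> / (l i (1 - \<theta>) + \<theta>),
    f \<theta> is the squared norm of \<alpha> w for \<theta> < 1. It is 0 at 0 and |p|^2 at 1, and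
    the intermediate value theorem makes it r^2.\<close>
  define f where "f \<theta> = (\<Sum>i<n. (\<theta> / (l i * (1 - \<theta>) + \<theta>))\<^sup>2 * (inner z (e i))\<^sup>2)" for \<theta>
  have den: "l i * (1 - \<theta>) + \<theta> > 0" if "0 \<le> \<theta>" "\<theta> \<le> 1" for i \<theta>
    using that l_pos[of i] by (cases "\<theta> = 1") (auto intro: add_pos_nonneg)
  have "continuous_on {0..1} f"
    unfolding f_def using den by (intro continuous_intros) (auto simp: less_imp_neq[symmetric])
  moreover have f1: "f 1 = (norm p)\<^sup>2"
    unfolding p_def norm_multiplier f_def by simp
  moreover have "f 0 \<le> r\<^sup>2"
    by (simp add: f_def)
  moreover have pr: "r\<^sup>2 < (norm p)\<^sup>2"
    using p r by (intro power_strict_mono) auto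
  ultimately obtain \<theta> where \<theta>: "0 \<le> \<theta>" "\<theta> \<le> 1" "f \<theta> = r\<^sup>2"
    using IVT'[of f 0 "r\<^sup>2" 1] by auto
  have "\<theta> \<noteq> 1"
    using f1 pr \<theta>(3) by auto
  define \<alpha> where "\<alpha> = \<theta> / (1 - \<theta>)"
  have \<alpha>: "\<alpha> \<ge> 0"
    using \<theta> by (simp add: \<alpha>_def)
  \<comment> \<open>The coefficients are 1 / (l i + \<alpha>), cleared of the inner
    fraction.\<close>
  define w where "w = multiplier n (\<lambda>i. (1 - \<theta>) / (l i * (1 - \<theta>) + \<theta>)) z"
  have "\<alpha> * ((1 - \<theta>) / (l i * (1 - \<theta>) + \<theta>)) = \<theta> / (l i * (1 - \<theta>) + \<theta>)" for i
    using \<open>\<theta> \<noteq> 1\<close> by (simp add: \<alpha>_def)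
  note eq = this
  have aw: "\<alpha> *\<^sub>R w = multiplier n (\<lambda>i. \<theta> / (l i * (1 - \<theta>) + \<theta>)) z"
    unfolding w_def multiplier_scaleR eq ..
  have "(norm (\<alpha> *\<^sub>R w))\<^sup>2 = r\<^sup>2"
    unfolding aw norm_multiplier \<theta>(3)[symmetric] f_def ..
  then have nw: "\<alpha> * norm w = r"
    using \<alpha> r by (simp add: power2_eq_iff_nonneg)
  have "l i * ((1 - \<theta>) / (l i * (1 - \<theta>) + \<theta>)) + \<theta> / (l i * (1 - \<theta>) + \<theta>) = 1" for i
    using den[OF \<theta>(1,2), of i] by (simp add: less_imp_neq[symmetric] flip: add_divide_distrib)
  then have pw: "C w + \<alpha> *\<^sub>R w = p"
    unfolding aw unfolding w_def p_def C_multiplier multiplier_add by simp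
  \<comment> \<open>The residual is - \<alpha> w. Half of the final 2 r comes from here, half from
    the truncation.\<close>
  then have "norm (C w - p) = r"
    using nw \<alpha> by (metis abs_of_nonneg add_diff_cancel_left' norm_minus_commute norm_scaleR)
  then have "norm (C w - z) \<le> 2 * r"
    using n norm_triangle_ineq[of "C w - p" "p - z"] by (simp add: p_def)
  moreover have "inner w z = inner w p"
    unfolding w_def p_def inner_multiplier2 unfolding inner_multiplier by simp
  \<comment> \<open>Pairing w with p = C w + \<alpha> w gives the extra term \<alpha> |w|^2 = r |w|,
    which cancels the penalty r |w| in the next identity.\<close>
  then have "inner w z = inner (C w) w + r * norm w"
    unfolding pw[symmetric] nw[symmetric]
    by (simp add: inner_add_right inner_commute dot_square_norm power2_eq_square mult.assoc)
  then have "inner (C w) w / 2 - inner w z + r * norm w = - (norm (S w))\<^sup>2 / 2"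
    by (simp add: norm_S)
  ultimately show thesis
    by (rule that)
qed

end

section \<open>Upper and lower bounds for balls\<close>

context gaussian
begin

lemma anderson_emeasure: "emeasure \<mu> (ball z r) \<le> emeasure \<mu> (ball 0 r)"
proof (rule emeasure_ball_le)
  obtain e l where "eigenbasis e C l"
    using eigenbasis_exists[OF positive_C trace_class_C inj_C] .
  then interpret eigenbasis e C l .
  \<comment> \<open>The centre without its first n coordinates. It becomes small but perhaps never
    zero, so the statement is proved for radii s < r with y n shorter than r - s.\<close>
  define y where "y n = z - multiplier n (\<lambda>_. 1) z" for n
  have step: "emeasure \<mu> (ball z s) \<le> emeasure \<mu> (ball (y n) s)" for n s
  proof (induction n)
    case (Suc n)
    have "y (Suc n) = y n - inner (y n) (e n) *\<^sub>R e n"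
      by (simp add: y_def inner_diff_left inner_multiplier_e) (simp add: multiplier_def)
    moreover have "emeasure \<mu> (ball (y n) s) \<le> emeasure \<mu> (ball (y n - inner (y n) (e n) *\<^sub>R e n) s)"
      using unit[of n] emeasure_ball_remove_coordinate[OF _ eigen l_pos, of n "y n" s] by auto
    ultimately show ?case
      using Suc by simp
  qed (simp add: y_def multiplier_def)
  fix s assume "s < r"
  then obtain n where "norm (multiplier n (\<lambda>_. 1) z - z) < r - s"
    using LIMSEQ_D[OF multiplier_tendsto, of "r - s" z] by auto
  then have n: "norm (y n) < r - s"
    by (simp add: y_def norm_minus_commute)
  have "ball (y n) s \<subseteq> ball 0 r"
  proof
    fix x assume "x \<in> ball (y n) s"
    then show "x \<in> ball 0 r"
      using n norm_triangle_ineq[of "x - y n" "y n"] by (simp add: dist_norm norm_minus_commute)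
  qed
  then have "emeasure \<mu> (ball (y n) s) \<le> emeasure \<mu> (ball 0 r)"
    by (intro emeasure_mono) auto
  with step[of s n] show "emeasure \<mu> (ball z s) \<le> emeasure \<mu> (ball 0 r)"
    by simp
qed simp

lemma anderson: "measure \<mu> (ball z r) \<le> measure \<mu> (ball 0 r)"
  using anderson_emeasure[of z r] by (simp add: emeasure_eq_measure)

text \<open>If the centred ball were null, Anderson's inequality would make all balls of that radius
  null, and countably many of them cover the space.\<close>

lemma measure_ball_pos:
  assumes "r > 0"
  shows "0 < measure \<mu> (ball 0 r)"
proof (rule ccontr)
  assume "\<not> 0 < measure \<mu> (ball 0 r)"
  then have "measure \<mu> (ball z r) = 0" for z
    using anderson[of z r] measure_nonneg[of \<mu> "ball z r"] by linarith
  then have null: "ball z r \<in> null_sets \<mu>" for z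
    by (auto simp: null_sets_def emeasure_eq_measure)
  obtain D :: "'a set" where D: "countable D" "\<And>X. open X \<Longrightarrow> X \<noteq> {} \<Longrightarrow> \<exists>d\<in>D. d \<in> X"
    using countable_dense_setE by blast
  have "(\<Union>d\<in>D. ball d r) = UNIV"
  proof (intro set_eqI iffI UNIV_I)
    fix x
    obtain d where "d \<in> D" "d \<in> ball x r"
      using D(2)[of "ball x r"] assms by auto
    then show "x \<in> (\<Union>d\<in>D. ball d r)"
      by (auto simp: dist_commute)
  qed
  then have "UNIV \<in> null_sets \<mu>"
    using null_sets_UN'[OF D(1), of "\<lambda>d. ball d r" \<mu>] null by simp
  then show False
    using emeasure_space_1 by (simp add: null_sets_def)
qed

text \<open>On the ball at z the density of the shift by C w is at least exp c. Its integral there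
  is the measure of the ball at z - C w, to which Anderson's inequality applies.\<close>

lemma measure_ball_upper:
  "measure \<mu> (ball z r) \<le> exp (inner (C w) w / 2 - inner w z + r * norm w) * measure \<mu> (ball 0 r)"
proof -
  define c where "c = inner w z - r * norm w - inner (C w) w / 2"
  have "ennreal (exp c) * emeasure \<mu> (ball z r) = (\<integral>\<^sup>+x. ennreal (exp c) * indicator (ball z r) x \<partial>\<mu>)"
    by (subst nn_integral_cmult_indicator) simp_all
  also have "\<dots> \<le> (\<integral>\<^sup>+x. ennreal (exp (inner x w - inner (C w) w / 2)) * indicator (ball z r) x \<partial>\<mu>)"
  proof (intro nn_integral_mono)
    fix x
    show "ennreal (exp c) * indicator (ball z r) x
        \<le> ennreal (exp (inner x w - inner (C w) w / 2)) * indicator (ball z r) x"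
    proof (cases "x \<in> ball z r")
      case True
      have "inner (z - x) w \<le> norm (z - x) * norm w"
        by (rule norm_cauchy_schwarz)
      also have "\<dots> \<le> r * norm w"
        using True by (intro mult_right_mono) (auto simp: dist_norm)
      finally have "c \<le> inner x w - inner (C w) w / 2"
        by (simp add: c_def inner_diff_left inner_commute[of w z])
      then show ?thesis
        using True by (simp add: ennreal_leI)
    qed simp
  qed
  also have "\<dots> \<le> emeasure \<mu> (ball 0 r)"
    unfolding emeasure_shifted_ball[symmetric] by (rule anderson_emeasure)
  finally have "exp c * measure \<mu> (ball z r) \<le> measure \<mu> (ball 0 r)"
    by (simp add: emeasure_eq_measure flip: ennreal_mult)
  then have "exp (- c) * (exp c * measure \<mu> (ball z r)) \<le> exp (- c) * measure \<mu> (ball 0 r)"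
    by (intro mult_left_mono) auto
  moreover have "exp (- c) * exp c = 1"
    by (simp flip: exp_add)
  ultimately have "measure \<mu> (ball z r) \<le> exp (- c) * measure \<mu> (ball 0 r)"
    by (simp only: mult.assoc[symmetric] mult_1_left)
  moreover have "- c = inner (C w) w / 2 - inner w z + r * norm w"
    by (simp add: c_def)
  ultimately show ?thesis
    by (simp only:)
qed

text \<open>The balls at C w and - C w have equal measure. In the sum of the two shift formulas the
  density is 2 cosh <x, w> exp (- q), at least 2 exp (- q).\<close>

lemma measure_ball_lower_C:
  "exp (- inner (C w) w / 2) * measure \<mu> (ball 0 r) \<le> measure \<mu> (ball (C w) r)"
proof -
  interpret C: bounded_linear C
    by (rule bounded_linear_C)
  define q where "q = inner (C w) w / 2"
  have 1: "emeasure \<mu> (ball (C w) r) = (\<integral>\<^sup>+x. ennreal (exp (inner x w - q)) * indicator (ball 0 r) x \<partial>\<mu>)"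
    using emeasure_shifted_ball[of 0 w r] emeasure_uminus_ball[of "C w" r] by (simp add: q_def)
  have 2: "emeasure \<mu> (ball (C w) r) = (\<integral>\<^sup>+x. ennreal (exp (- inner x w - q)) * indicator (ball 0 r) x \<partial>\<mu>)"
    using emeasure_shifted_ball[of 0 "- w" r] by (simp add: q_def C.neg)
  have [measurable]: "ball 0 r \<in> sets \<mu>"
    by simp
  have "ennreal (2 * exp (- q)) * emeasure \<mu> (ball 0 r) =
      (\<integral>\<^sup>+x. ennreal (2 * exp (- q)) * indicator (ball 0 r) x \<partial>\<mu>)"
    by (subst nn_integral_cmult_indicator) simp_all
  also have "\<dots> \<le> (\<integral>\<^sup>+x. ennreal (exp (inner x w - q)) * indicator (ball 0 r) x +
      ennreal (exp (- inner x w - q)) * indicator (ball 0 r) x \<partial>\<mu>)"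
  proof (intro nn_integral_mono)
    fix x
    have "2 * exp (- q) \<le> exp (inner x w - q) + exp (- inner x w - q)"
    proof -
      have "0 \<le> exp (- q) * (exp (inner x w / 2) - exp (- inner x w / 2))\<^sup>2"
        by simp
      also have "\<dots> = exp (inner x w - q) + exp (- inner x w - q) - 2 * exp (- q)"
        by (simp add: power2_eq_square algebra_simps flip: exp_add)
      finally show ?thesis by simp
    qed
    then show "ennreal (2 * exp (- q)) * indicator (ball 0 r) x
        \<le> ennreal (exp (inner x w - q)) * indicator (ball 0 r) x +
          ennreal (exp (- inner x w - q)) * indicator (ball 0 r) x"
      by (simp add: ennreal_leI split: split_indicator flip: ennreal_plus)
  qed
  also have "\<dots> = emeasure \<mu> (ball (C w) r) + emeasure \<mu> (ball (C w) r)"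
    by (subst nn_integral_add) (measurable, simp_all flip: 1 2)
  finally have "2 * exp (- q) * measure \<mu> (ball 0 r) \<le> measure \<mu> (ball (C w) r) + measure \<mu> (ball (C w) r)"
    by (simp add: emeasure_eq_measure flip: ennreal_mult ennreal_plus)
  then show ?thesis
    by (simp add: q_def)
qed

lemma op_sqrt_C: "positive_operator (op_sqrt C)" "op_sqrt C (op_sqrt C x) = C x" "inj (op_sqrt C)"
proof -
  obtain e l where "eigenbasis e C l"
    using eigenbasis_exists[OF positive_C trace_class_C inj_C] .
  then interpret eigenbasis e C l .
  show "positive_operator (op_sqrt C)" "op_sqrt C (op_sqrt C x) = C x" "inj (op_sqrt C)"
    unfolding op_sqrt_eq by (rule positive_S S_S inj_S)+
qed

text \<open>The bound for centres C w extends to S v by truncating v: with S w = p n one has C w = S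
  (p n), close to S v, and <C w, w> = |p n|^2 <= |v|^2.\<close>

lemma measure_ball_lower:
  "exp (- (norm v)\<^sup>2 / 2) * measure \<mu> (ball 0 r) \<le> measure \<mu> (ball (op_sqrt C v) r)"
proof -
  obtain e l where "eigenbasis e C l"
    using eigenbasis_exists[OF positive_C trace_class_C inj_C] .
  then interpret eigenbasis e C l .
  interpret S: bounded_linear S
    by (rule positive_operatorD[OF positive_S])
  define c where "c = exp ((norm v)\<^sup>2 / 2) * measure \<mu> (ball (S v) r)"
  have "emeasure \<mu> (ball 0 r) \<le> ennreal c"
  proof (rule emeasure_ball_le)
    fix s assume "s < r"
    define p where "p n = multiplier n (\<lambda>_. 1) v" for n
    have "(\<lambda>n. S (p n)) \<longlonglongrightarrow> S v"
      unfolding p_def by (rule S.tendsto[OF multiplier_tendsto])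
    then obtain n where n: "norm (S (p n) - S v) < r - s"
      using LIMSEQ_D[of _ "S v" "r - s"] \<open>s < r\<close> by fastforce
    define w where "w = multiplier n (\<lambda>i. 1 / sqrt (l i)) v"
    have "S w = p n"
      unfolding w_def p_def S_multiplier using l_pos by (simp add: less_imp_neq[symmetric])
    then have Cw: "C w = S (p n)" and norm_w: "inner (C w) w = (norm (p n))\<^sup>2"
      using S_S[of w] norm_S[of w] by simp_all
    have "ball (C w) s \<subseteq> ball (S v) r"
    proof
      fix x assume "x \<in> ball (C w) s"
      then show "x \<in> ball (S v) r"
        using n dist_triangle[of "S v" x "C w"] by (simp add: Cw dist_norm norm_minus_commute)
    qed
    have "norm (p n) \<le> norm v"
      unfolding p_def by (rule norm_multiplier_one_le)
    then have "(norm (p n))\<^sup>2 \<le> (norm v)\<^sup>2"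
      by (simp add: power_mono)
    then have "exp (- (norm v)\<^sup>2 / 2) * measure \<mu> (ball 0 s) \<le> exp (- inner (C w) w / 2) * measure \<mu> (ball 0 s)"
      unfolding norm_w by (intro mult_right_mono) auto
    also have "\<dots> \<le> measure \<mu> (ball (C w) s)"
      by (rule measure_ball_lower_C)
    also have "\<dots> \<le> measure \<mu> (ball (S v) r)"
      using \<open>ball (C w) s \<subseteq> ball (S v) r\<close> by (intro finite_measure_mono) auto
    finally have "exp ((norm v)\<^sup>2 / 2) * (exp (- (norm v)\<^sup>2 / 2) * measure \<mu> (ball 0 s)) \<le> c"
      unfolding c_def by (intro mult_left_mono) auto
    then have "measure \<mu> (ball 0 s) \<le> c"
      by (simp add: mult.assoc[symmetric] flip: exp_add)
    then show "emeasure \<mu> (ball 0 s) \<le> ennreal c"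
      by (simp add: emeasure_eq_measure ennreal_leI)
  qed simp
  then have "measure \<mu> (ball 0 r) \<le> c"
    by (simp add: emeasure_eq_measure c_def)
  then have "exp (- (norm v)\<^sup>2 / 2) * measure \<mu> (ball 0 r) \<le> exp (- (norm v)\<^sup>2 / 2) * c"
    by (intro mult_left_mono) auto
  then show ?thesis
    by (simp add: c_def op_sqrt_eq mult.assoc[symmetric] flip: exp_add)
qed

text \<open>Take v = S w for the Tikhonov vector w, so that S v = C w. Centres with |z| <= 2 r are
  served by v = 0 and Anderson's inequality.\<close>

lemma measure_ball_upper_norm:
  assumes "r > 0"
  obtains v where "norm (op_sqrt C v - z) \<le> 2 * r"
    and "measure \<mu> (ball z r) \<le> exp (- (norm v)\<^sup>2 / 2) * measure \<mu> (ball 0 r)"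
proof -
  obtain e l where "eigenbasis e C l"
    using eigenbasis_exists[OF positive_C trace_class_C inj_C] .
  then interpret eigenbasis e C l .
  interpret S: bounded_linear S
    by (rule positive_operatorD[OF positive_S])
  show thesis
  proof (cases "norm z \<le> 2 * r")
    case True
    then show thesis
      using that[of 0] anderson[of z r] by (simp add: op_sqrt_eq S.zero)
  next
    case False
    then obtain w where "norm (C w - z) \<le> 2 * r"
      and "inner (C w) w / 2 - inner w z + r * norm w = - (norm (S w))\<^sup>2 / 2"
      using tikhonov[OF assms, of z] by auto
    then show thesis
      using that[of "S w"] measure_ball_upper[of z r w] by (simp add: op_sqrt_eq S_S)
  qed
qed

lemma range_op_sqrt_I:
  assumes "\<And>w. inner w x - inner (C w) w / 2 \<le> K"
  obtains v where "x = op_sqrt C v" "(norm v)\<^sup>2 / 2 \<le> K"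
proof -
  obtain e l where "eigenbasis e C l"
    using eigenbasis_exists[OF positive_C trace_class_C inj_C] .
  then interpret eigenbasis e C l .
  show thesis
    using range_S_I[OF assms] that unfolding op_sqrt_eq by blast
qed

end

section \<open>Modes of tilted Gaussian measures\<close>

text \<open>Collects what the mode analysis uses of the potential: Lipschitz continuity on balls
  controls it at nearby points, the linear lower bound far away.\<close>

locale gaussian_tilt = gaussian \<mu> C
  for \<mu> :: "'a::{real_inner,polish_space} measure" and C :: "'a \<Rightarrow> 'a" +
  fixes \<Phi> :: "'a \<Rightarrow> real" and Z K :: real
  assumes Z: "Z > 0" and K: "K \<ge> 0"
    and \<Phi>_lipschitz: "r > 0 \<Longrightarrow> \<exists>L. L-lipschitz_on (ball 0 r) \<Phi>"
    and \<Phi>_lower: "- K * (1 + norm u) \<le> \<Phi> u"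
    and prob_tilt: "prob_space (density \<mu> (\<lambda>u. ennreal (1 / Z * exp (- \<Phi> u))))"
begin

definition \<nu> :: "'a measure" where
  "\<nu> = density \<mu> (\<lambda>u. ennreal (1 / Z * exp (- \<Phi> u)))"

sublocale tilt: prob_space \<nu>
  unfolding \<nu>_def by (rule prob_tilt)

lemma borel_measurable_\<Phi> [measurable]: "\<Phi> \<in> borel_measurable borel"
proof (rule borel_measurable_continuous_onI)
  show "continuous_on UNIV \<Phi>"
    unfolding continuous_on_eq_continuous_at[OF open_UNIV]
  proof
    fix x :: 'a
    obtain L where "L-lipschitz_on (ball 0 (norm x + 1)) \<Phi>"
      using \<Phi>_lipschitz[of "norm x + 1"] by (auto simp: add_nonneg_pos)
    then have "continuous_on (ball 0 (norm x + 1)) \<Phi>"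
      by (rule lipschitz_on_continuous_on)
    then show "isCont \<Phi> x"
      by (simp add: continuous_on_eq_continuous_at)
  qed
qed

lemma emeasure_\<nu>_ball:
  "emeasure \<nu> (ball z r) = (\<integral>\<^sup>+u. ennreal (1 / Z * exp (- \<Phi> u)) * indicator (ball z r) u \<partial>\<mu>)"
proof -
  have [measurable]: "\<Phi> \<in> borel_measurable \<mu>"
    using borel_measurable_\<Phi> measurable_cong_sets[OF sets_eq refl] by blast
  show ?thesis
    unfolding \<nu>_def by (intro emeasure_density) simp_all
qed

lemma measure_\<nu>_ball_le:
  assumes "\<And>u. u \<in> ball z r \<Longrightarrow> a \<le> \<Phi> u"
  shows "measure \<nu> (ball z r) \<le> exp (- a) / Z * measure \<mu> (ball z r)"
proof -
  have "emeasure \<nu> (ball z r) \<le> (\<integral>\<^sup>+u. ennreal (exp (- a) / Z) * indicator (ball z r) u \<partial>\<mu>)"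
    unfolding emeasure_\<nu>_ball using assms Z
    by (intro nn_integral_mono) (auto simp: divide_right_mono intro!: ennreal_leI split: split_indicator)
  also have "\<dots> = ennreal (exp (- a) / Z) * emeasure \<mu> (ball z r)"
    by (rule nn_integral_cmult_indicator) simp
  finally show ?thesis
    using Z by (simp add: emeasure_eq_measure tilt.emeasure_eq_measure flip: ennreal_mult)
qed

lemma measure_\<nu>_ball_ge:
  assumes "\<And>u. u \<in> ball z r \<Longrightarrow> \<Phi> u \<le> a"
  shows "exp (- a) / Z * measure \<mu> (ball z r) \<le> measure \<nu> (ball z r)"
proof -
  have "ennreal (exp (- a) / Z) * emeasure \<mu> (ball z r) =
      (\<integral>\<^sup>+u. ennreal (exp (- a) / Z) * indicator (ball z r) u \<partial>\<mu>)"
    by (rule nn_integral_cmult_indicator[symmetric]) simp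
  also have "\<dots> \<le> emeasure \<nu> (ball z r)"
    unfolding emeasure_\<nu>_ball using assms Z
    by (intro nn_integral_mono) (auto simp: divide_right_mono intro!: ennreal_leI split: split_indicator)
  finally show ?thesis
    using Z by (simp add: emeasure_eq_measure tilt.emeasure_eq_measure flip: ennreal_mult)
qed

lemma \<Phi>_local:
  obtains L where "L \<ge> 0"
    and "\<And>u r. r < 1 \<Longrightarrow> u \<in> ball x r \<Longrightarrow> \<bar>\<Phi> u - \<Phi> x\<bar> \<le> L * r"
proof -
  obtain L where L: "L-lipschitz_on (ball 0 (norm x + 1)) \<Phi>"
    using \<Phi>_lipschitz[of "norm x + 1"] by (auto simp: add_nonneg_pos)
  show thesis
  proof (rule that[of L])
    show "L \<ge> 0"
      using L by (rule lipschitz_on_nonneg)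
    fix u r assume r: "r < 1" and u: "u \<in> ball x r"
    then have "dist u x < r"
      by (simp add: dist_commute)
    moreover have "norm u < norm x + 1"
      using norm_triangle_ineq2[of u x] r \<open>dist u x < r\<close> by (simp add: dist_norm)
    ultimately have "\<bar>\<Phi> u - \<Phi> x\<bar> \<le> L * dist u x"
      using lipschitz_onD[OF L, of u x] by (simp add: dist_real_def)
    also have "\<dots> \<le> L * r"
      using \<open>L \<ge> 0\<close> \<open>dist u x < r\<close> by (intro mult_left_mono) auto
    finally show "\<bar>\<Phi> u - \<Phi> x\<bar> \<le> L * r" .
  qed
qed

text \<open>I pulled back along S, which turns the Cameron-Martin norm into the plain norm of
  v.\<close>

definition energy :: "'a \<Rightarrow> real" where
  "energy v = \<Phi> (op_sqrt C v) + (norm v)\<^sup>2 / 2"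

lemma measure_\<nu>_ball_lower:
  obtains L where
    "\<And>r. r < 1 \<Longrightarrow> exp (- energy v - L * r) / Z * measure \<mu> (ball 0 r) \<le> measure \<nu> (ball (op_sqrt C v) r)"
proof -
  obtain L where L: "\<And>u r. r < 1 \<Longrightarrow> u \<in> ball (op_sqrt C v) r \<Longrightarrow> \<bar>\<Phi> u - \<Phi> (op_sqrt C v)\<bar> \<le> L * r"
    using \<Phi>_local by metis
  show thesis
  proof (rule that[of L])
    fix r :: real assume r: "r < 1"
    have "exp (- energy v - L * r) / Z * measure \<mu> (ball 0 r) =
        exp (- (\<Phi> (op_sqrt C v) + L * r)) / Z * (exp (- (norm v)\<^sup>2 / 2) * measure \<mu> (ball 0 r))"
      by (simp add: energy_def field_simps flip: exp_add)
    also have "\<dots> \<le> exp (- (\<Phi> (op_sqrt C v) + L * r)) / Z * measure \<mu> (ball (op_sqrt C v) r)"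
      using Z by (intro mult_left_mono measure_ball_lower) simp
    also have "\<dots> \<le> measure \<nu> (ball (op_sqrt C v) r)"
      using L[OF r] by (intro measure_\<nu>_ball_ge) fastforce
    finally show "exp (- energy v - L * r) / Z * measure \<mu> (ball 0 r) \<le> measure \<nu> (ball (op_sqrt C v) r)" .
  qed
qed

section \<open>Modes and minimizers of the energy\<close>

lemma measure_\<nu>_ball_le_SUP: "measure \<nu> (ball z r) \<le> (SUP z. measure \<nu> (ball z r))"
  by (intro cSUP_upper bdd_aboveI[of _ 1]) auto

lemma mode_imp_minimizer:
  assumes "strong_mode \<nu> x"
  obtains v where "x = op_sqrt C v" "\<And>v'. energy v \<le> energy v'"
proof -
  define M where "M r = (SUP z. measure \<nu> (ball z r))" for r
  have lim: "((\<lambda>r. measure \<nu> (ball x r) / M r) \<longlongrightarrow> 1) (at_right 0)"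
    using assms unfolding strong_mode_def M_def .
  \<comment> \<open>Fix w and v' first and let r -> 0: all errors are O(r), and the mode property
    leaves 1 <= exp E. Only afterwards does w vary, and the supremum over w is half the squared
    Cameron-Martin norm of x.\<close>
  have key: "inner w x - inner (C w) w / 2 \<le> energy v' - \<Phi> x" for w v'
  proof -
    obtain L1 where L1: "\<And>u r. r < 1 \<Longrightarrow> u \<in> ball x r \<Longrightarrow> \<bar>\<Phi> u - \<Phi> x\<bar> \<le> L1 * r"
      using \<Phi>_local by metis
    obtain L2 where L2: "\<And>r. r < 1 \<Longrightarrow>
        exp (- energy v' - L2 * r) / Z * measure \<mu> (ball 0 r) \<le> measure \<nu> (ball (op_sqrt C v') r)"
      using measure_\<nu>_ball_lower by metis
    define E where "E = energy v' - \<Phi> x + inner (C w) w / 2 - inner w x"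
    have "measure \<nu> (ball x r) / M r \<le> exp (E + (L1 + norm w + L2) * r)" if r: "0 < r" "r < 1" for r
    proof -
      have c: "measure \<mu> (ball 0 r) > 0"
        using r by (intro measure_ball_pos)
      have "measure \<nu> (ball x r) \<le> exp (- (\<Phi> x - L1 * r)) / Z * measure \<mu> (ball x r)"
        using L1[OF r(2)] by (intro measure_\<nu>_ball_le) fastforce
      also have "\<dots> \<le> exp (- (\<Phi> x - L1 * r)) / Z *
          (exp (inner (C w) w / 2 - inner w x + r * norm w) * measure \<mu> (ball 0 r))"
        using Z by (intro mult_left_mono measure_ball_upper) simp
      also have "\<dots> = exp (E + (L1 + norm w + L2) * r) *
          (exp (- energy v' - L2 * r) / Z * measure \<mu> (ball 0 r))"
        by (simp add: E_def field_simps flip: exp_add)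
      also have "\<dots> \<le> exp (E + (L1 + norm w + L2) * r) * M r"
        unfolding M_def by (intro mult_left_mono order_trans[OF L2[OF r(2)] measure_\<nu>_ball_le_SUP]) simp
      finally have le: "measure \<nu> (ball x r) \<le> exp (E + (L1 + norm w + L2) * r) * M r" .
      have "0 < exp (- energy v' - L2 * r) / Z * measure \<mu> (ball 0 r)"
        using c Z by simp
      also have "\<dots> \<le> M r"
        unfolding M_def by (rule order_trans[OF L2[OF r(2)] measure_\<nu>_ball_le_SUP])
      finally show ?thesis
        using le by (simp add: divide_le_eq)
    qed
    then have "eventually (\<lambda>r. measure \<nu> (ball x r) / M r \<le> exp (E + (L1 + norm w + L2) * r)) (at_right 0)"
      by (auto intro!: eventually_at_right_less simp: eventually_at_right_field intro: exI[of _ 1])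
    moreover have "((\<lambda>r. exp (E + (L1 + norm w + L2) * r)) \<longlongrightarrow> exp (E + (L1 + norm w + L2) * 0)) (at_right 0)"
      by (intro tendsto_intros)
    ultimately have "1 \<le> exp (E + (L1 + norm w + L2) * 0)"
      using tendsto_le[OF trivial_limit_at_right_real _ lim] by blast
    then show ?thesis
      by (simp add: E_def)
  qed
  have "\<exists>v. x = op_sqrt C v \<and> (norm v)\<^sup>2 / 2 \<le> energy v' - \<Phi> x" for v'
    using range_op_sqrt_I[OF key] by metis
  then have "\<exists>v. x = op_sqrt C v \<and> energy v \<le> energy v'" for v'
    unfolding energy_def[of "_ :: 'a"] by (metis add.commute le_diff_eq)
  \<comment> \<open>So far v may depend on v'; injectivity of the square root makes it one
    vector.\<close>
  then show thesis
    using that injD[OF op_sqrt_C(3)] by metis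
qed

text \<open>For |z| <= R, points of the ball are within r + 2 r of S v, so \<Phi> is replaced by
  \<Phi> (S v) at cost 3 L r and the exponent is controlled by the energy. For |z| > R the vector v
  is long and the quadratic term outweighs the linear lower bound.\<close>

lemma SUP_measure_\<nu>_ball_le:
  assumes min: "\<And>v. m \<le> energy v"
  obtains L where
    "\<And>r. 0 < r \<Longrightarrow> r < 1 \<Longrightarrow> (SUP z. measure \<nu> (ball z r)) \<le> exp (- m + L * r) / Z * measure \<mu> (ball 0 r)"
proof -
  interpret S: bounded_linear "op_sqrt C"
    by (rule positive_operatorD[OF op_sqrt_C(1)])
  obtain s where s: "s > 0" "\<And>v. norm (op_sqrt C v) \<le> norm v * s"
    using S.pos_bounded by blast
  \<comment> \<open>Ensures t / 2 - K s >= 1 + 4 K + |m| and t >= 1 for t >= T; the product t (t / 2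
    - K s) then exceeds 4 K + m.\<close>
  define T where "T = 2 * K * s + 2 * (1 + 4 * K + \<bar>m\<bar>)"
  have T: "K * (4 + s * t) - t\<^sup>2 / 2 \<le> - m" if "t \<ge> T" for t
  proof -
    have "1 + 4 * K + \<bar>m\<bar> \<le> t / 2 - K * s"
      using that by (simp add: T_def)
    moreover have "1 \<le> t"
      using that K mult_nonneg_nonneg[OF K less_imp_le[OF s(1)]] by (simp add: T_def)
    ultimately have "1 * (1 + 4 * K + \<bar>m\<bar>) \<le> t * (t / 2 - K * s)"
      using K by (intro mult_mono) auto
    then show ?thesis
      by (simp add: algebra_simps power2_eq_square)
  qed
  \<comment> \<open>The 2 pays for |S v - z| <= 2 r < 2, so |z| > R forces s |v| > s T. The radius R
    + 3 below contains both the ball at z and S v whenever |z| <= R.\<close>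
  define R where "R = s * T + 2"
  have "R > 0"
    using s K by (simp add: R_def T_def add_nonneg_pos)
  then obtain L where L: "L-lipschitz_on (ball 0 (R + 3)) \<Phi>"
    using \<Phi>_lipschitz[of "R + 3"] by auto
  have L0: "L \<ge> 0"
    using L by (rule lipschitz_on_nonneg)
  show thesis
  proof (rule that[of "3 * L"])
    fix r :: real assume r: "0 < r" "r < 1"
    show "(SUP z. measure \<nu> (ball z r)) \<le> exp (- m + 3 * L * r) / Z * measure \<mu> (ball 0 r)"
    proof (intro cSUP_least)
      fix z
      obtain v where v: "norm (op_sqrt C v - z) \<le> 2 * r"
        "measure \<mu> (ball z r) \<le> exp (- (norm v)\<^sup>2 / 2) * measure \<mu> (ball 0 r)"
        using measure_ball_upper_norm[OF r(1)] by blast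
      have near: "norm (u - op_sqrt C v) \<le> 3 * r" if "u \<in> ball z r" for u
        using that v(1) norm_triangle_ineq[of "u - z" "z - op_sqrt C v"]
        by (simp add: dist_norm norm_minus_commute)
      have bound: "measure \<nu> (ball z r) \<le> exp (- m + 3 * L * r) / Z * measure \<mu> (ball 0 r)"
        if a: "\<And>u. u \<in> ball z r \<Longrightarrow> a \<le> \<Phi> u" and am: "- a - (norm v)\<^sup>2 / 2 \<le> - m + 3 * L * r" for a
      proof -
        have "measure \<nu> (ball z r) \<le> exp (- a) / Z * measure \<mu> (ball z r)"
          by (rule measure_\<nu>_ball_le[OF a])
        also have "\<dots> \<le> exp (- a) / Z * (exp (- (norm v)\<^sup>2 / 2) * measure \<mu> (ball 0 r))"
          using Z v(2) by (intro mult_left_mono) simp_all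
        also have "\<dots> = exp (- a - (norm v)\<^sup>2 / 2) / Z * measure \<mu> (ball 0 r)"
          by (simp flip: exp_add)
        also have "\<dots> \<le> exp (- m + 3 * L * r) / Z * measure \<mu> (ball 0 r)"
          using Z am by (intro mult_right_mono divide_right_mono) simp_all
        finally show ?thesis .
      qed
      show "measure \<nu> (ball z r) \<le> exp (- m + 3 * L * r) / Z * measure \<mu> (ball 0 r)"
      proof (cases "norm z \<le> R")
        case True
        show ?thesis
        proof (rule bound[of "\<Phi> (op_sqrt C v) - 3 * L * r"])
          fix u assume u: "u \<in> ball z r"
          have "norm u < R + 3"
            using u r True norm_triangle_ineq[of "u - z" z] by (simp add: dist_norm norm_minus_commute)
          moreover have "norm (op_sqrt C v) < R + 3"
            using v(1) r True norm_triangle_ineq[of "op_sqrt C v - z" z] by simp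
          ultimately have "\<bar>\<Phi> u - \<Phi> (op_sqrt C v)\<bar> \<le> L * norm (u - op_sqrt C v)"
            using lipschitz_onD[OF L, of u "op_sqrt C v"] by (simp add: dist_norm)
          also have "\<dots> \<le> L * (3 * r)"
            by (intro mult_left_mono near[OF u] L0)
          finally show "\<Phi> (op_sqrt C v) - 3 * L * r \<le> \<Phi> u"
            by (simp add: abs_le_iff algebra_simps)
        qed (use min[of v] in \<open>simp add: energy_def\<close>)
      next
        case False
        define t where "t = norm v"
        have St: "norm (op_sqrt C v) \<le> s * t"
          using s(2)[of v] by (simp add: t_def mult.commute)
        have "R - 2 < norm (op_sqrt C v)"
          using False v(1) r norm_triangle_ineq2[of z "op_sqrt C v"] by (simp add: norm_minus_commute)
        then have "s * T < s * t"
          using St by (simp add: R_def)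
        then have "T \<le> t"
          using s(1) by simp
        show ?thesis
        \<comment> \<open>From |u| <= |S v| + 3 r <= s t + 3 one gets 1 + |u| <= 4 + s t.\<close>
        proof (rule bound[of "- K * (4 + s * t)"])
          fix u assume u: "u \<in> ball z r"
          have "norm u \<le> 3 + s * t"
            using near[OF u] r St norm_triangle_ineq[of "u - op_sqrt C v" "op_sqrt C v"] by simp
          then have "K * (1 + norm u) \<le> K * (4 + s * t)"
            using K by (intro mult_left_mono) auto
          then show "- K * (4 + s * t) \<le> \<Phi> u"
            using \<Phi>_lower[of u] by simp
        next
          have "0 \<le> 3 * L * r"
            using L0 r by simp
          then show "- (- K * (4 + s * t)) - (norm v)\<^sup>2 / 2 \<le> - m + 3 * L * r"
            using T[OF \<open>T \<le> t\<close>] by (simp add: t_def)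
        qed
      qed
    qed simp
  qed
qed

text \<open>With m = \<open>energy v\<close> the upper bound for the supremum and the lower bound at
  S v share all factors that do not tend to 1, so the ratio is squeezed between exp (- (L1 + L2) r)
  and 1.\<close>

lemma minimizer_imp_mode:
  assumes min: "\<And>v'. energy v \<le> energy v'"
  shows "strong_mode \<nu> (op_sqrt C v)"
proof -
  define M where "M r = (SUP z. measure \<nu> (ball z r))" for r
  obtain L1 where L1: "\<And>r. 0 < r \<Longrightarrow> r < 1 \<Longrightarrow> M r \<le> exp (- energy v + L1 * r) / Z * measure \<mu> (ball 0 r)"
    using SUP_measure_\<nu>_ball_le[OF min] unfolding M_def by metis
  obtain L2 where L2: "\<And>r. r < 1 \<Longrightarrow>
      exp (- energy v - L2 * r) / Z * measure \<mu> (ball 0 r) \<le> measure \<nu> (ball (op_sqrt C v) r)"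
    using measure_\<nu>_ball_lower by metis
  have bounds: "exp (- (L1 + L2) * r) \<le> measure \<nu> (ball (op_sqrt C v) r) / M r"
      "measure \<nu> (ball (op_sqrt C v) r) / M r \<le> 1" if r: "0 < r" "r < 1" for r
  proof -
    have "0 < exp (- energy v - L2 * r) / Z * measure \<mu> (ball 0 r)"
      using measure_ball_pos[OF r(1)] Z by simp
    then have Mpos: "0 < M r" and le: "measure \<nu> (ball (op_sqrt C v) r) \<le> M r"
      using L2[OF r(2)] measure_\<nu>_ball_le_SUP[of "op_sqrt C v" r] unfolding M_def by linarith+
    show "measure \<nu> (ball (op_sqrt C v) r) / M r \<le> 1"
      using Mpos le by simp
    have "exp (- (L1 + L2) * r) * M r \<le>
        exp (- (L1 + L2) * r) * (exp (- energy v + L1 * r) / Z * measure \<mu> (ball 0 r))"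
      by (intro mult_left_mono L1 r) simp
    also have "\<dots> = exp (- energy v - L2 * r) / Z * measure \<mu> (ball 0 r)"
      by (simp add: field_simps flip: exp_add)
    also have "\<dots> \<le> measure \<nu> (ball (op_sqrt C v) r)"
      by (rule L2[OF r(2)])
    finally show "exp (- (L1 + L2) * r) \<le> measure \<nu> (ball (op_sqrt C v) r) / M r"
      using Mpos by (simp add: le_divide_eq)
  qed
  have ev: "eventually (\<lambda>r. 0 < r \<and> r < (1::real)) (at_right 0)"
    unfolding eventually_at_right_field by (intro exI[of _ 1]) auto
  have "((\<lambda>r. exp (- (L1 + L2) * r)) \<longlongrightarrow> exp (- (L1 + L2) * 0)) (at_right 0)"
    by (intro tendsto_intros)
  then have lim: "((\<lambda>r. exp (- (L1 + L2) * r)) \<longlongrightarrow> 1) (at_right 0)"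
    by simp
  have "((\<lambda>r. measure \<nu> (ball (op_sqrt C v) r) / M r) \<longlongrightarrow> 1) (at_right 0)"
    by (rule tendsto_sandwich[OF eventually_mono[OF ev] eventually_mono[OF ev] lim tendsto_const])
      (use bounds in blast)+
  then show ?thesis
    unfolding strong_mode_def M_def .
qed

theorem strong_mode_iff_arg_min:
  "strong_mode \<nu> x \<longleftrightarrow>
    is_arg_min (\<lambda>u. \<Phi> u + (norm (inv (op_sqrt C) u))\<^sup>2 / 2) (\<lambda>u. u \<in> range (op_sqrt C)) x"
    (is "_ \<longleftrightarrow> is_arg_min ?I _ x")
proof
  have I: "?I (op_sqrt C v) = energy v" for v
    by (simp add: energy_def inv_f_f[OF op_sqrt_C(3)])
  {
    assume "strong_mode \<nu> x"
    then obtain v where "x = op_sqrt C v" "\<And>v'. energy v \<le> energy v'"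
      by (rule mode_imp_minimizer) blast
    then show "is_arg_min ?I (\<lambda>u. u \<in> range (op_sqrt C)) x"
      unfolding is_arg_min_def using I by (auto simp: not_less)
  next
    assume *: "is_arg_min ?I (\<lambda>u. u \<in> range (op_sqrt C)) x"
    then obtain v where v: "x = op_sqrt C v"
      unfolding is_arg_min_def by auto
    have "energy v \<le> energy v'" for v'
      using * unfolding is_arg_min_def v by (auto simp: not_less I)
    then show "strong_mode \<nu> x"
      unfolding v by (rule minimizer_imp_mode)
  }
qed

end

lemma lipschitz_on_quadratic_form:
  assumes Q: "positive_operator Q" and G: "L-lipschitz_on A G" and B: "\<And>u. u \<in> A \<Longrightarrow> norm (G u) \<le> B"
  shows "\<exists>L'. L'-lipschitz_on A (\<lambda>u. inner (Q (G u)) (G u) / 2 - inner (G u) y)"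
proof (cases "A = {}")
  case False
  interpret Q: bounded_linear Q
    by (rule positive_operatorD[OF Q])
  obtain q where q: "q > 0" "\<And>x. norm (Q x) \<le> norm x * q"
    using Q.pos_bounded by blast
  have L: "L \<ge> 0"
    using G by (rule lipschitz_on_nonneg)
  obtain u0 where "u0 \<in> A"
    using False by auto
  then have "B \<ge> 0"
    using B[of u0] norm_ge_zero[of "G u0"] by linarith
  have "(L * (q * B + norm y))-lipschitz_on A (\<lambda>u. inner (Q (G u)) (G u) / 2 - inner (G u) y)"
  proof (rule lipschitz_onI)
    fix u v assume uv: "u \<in> A" "v \<in> A"
    define g where "g = G u"
    define h where "h = G v"
    \<comment> \<open>A difference of squares, valid by symmetry of Q; the factor g + h is bounded
      by 2 B, which confines the Lipschitz estimate to sets where G is bounded.\<close>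
    have "inner (Q (g - h)) (g + h) = inner (Q g) g - inner (Q h) h"
      using positive_operatorD(2)[OF Q, of g h]
      by (simp add: Q.diff inner_diff_left inner_diff_right inner_add_left inner_add_right inner_commute)
    then have eq: "(inner (Q g) g / 2 - inner g y) - (inner (Q h) h / 2 - inner h y) =
        inner (Q (g - h)) (g + h) / 2 - inner (g - h) y"
      by (simp add: inner_diff_left diff_divide_distrib)
    have "\<bar>inner (Q (g - h)) (g + h)\<bar> \<le> norm (Q (g - h)) * norm (g + h)"
      by (rule Cauchy_Schwarz_ineq2)
    also have "\<dots> \<le> (norm (g - h) * q) * (2 * B)"
      using B[OF uv(1)] B[OF uv(2)] norm_triangle_ineq[of g h] q(1) unfolding g_def h_def
      by (intro mult_mono q(2)) auto
    finally have 1: "\<bar>inner (Q (g - h)) (g + h)\<bar> / 2 \<le> norm (g - h) * (q * B)"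
      by (simp add: mult_ac)
    have 2: "\<bar>inner (g - h) y\<bar> \<le> norm (g - h) * norm y"
      by (rule Cauchy_Schwarz_ineq2)
    have "dist (inner (Q g) g / 2 - inner g y) (inner (Q h) h / 2 - inner h y) \<le> norm (g - h) * (q * B + norm y)"
      unfolding dist_real_def eq distrib_left using 1 2 by linarith
    also have "\<dots> \<le> (L * dist u v) * (q * B + norm y)"
      using lipschitz_onD[OF G uv] q(1) \<open>B \<ge> 0\<close> unfolding g_def h_def dist_norm
      by (intro mult_right_mono) auto
    finally show "dist (inner (Q (G u)) (G u) / 2 - inner (G u) y) (inner (Q (G v)) (G v) / 2 - inner (G v) y)
        \<le> L * (q * B + norm y) * dist u v"
      by (simp add: g_def h_def mult_ac)
  qed (use L q \<open>B \<ge> 0\<close> in simp)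
  then show ?thesis ..
qed auto

text \<open>The norm bound c of the linear map serves as Lipschitz constant on every ball and as
  \<open>L0\<close>.\<close>

lemma condition_B_imp_condition_A:
  assumes "condition_B Q F"
  shows "condition_A Q F"
proof -
  define G where "G = inv Q \<circ> F"
  interpret G: bounded_linear G
    using assms by (simp add: condition_B_def G_def)
  obtain c where c: "c > 0" "\<And>u. norm (G u) \<le> norm u * c"
    using G.pos_bounded by blast
  have "c-lipschitz_on (ball 0 r) G" for r
    using c by (intro lipschitz_onI) (simp_all add: dist_norm mult.commute flip: G.diff)
  moreover have "norm (G u - G 0) \<le> c * norm u" for u
    using c(2)[of u] by (simp add: G.zero mult.commute)
  ultimately show ?thesis
    using assms c(1) unfolding condition_A_def condition_B_def lipschitz_on_bounded_sets_def G_def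
    by (auto simp: comp_def)
qed

theorem theorem3p4:
  fixes F :: "'x::{real_inner, polish_space} \<Rightarrow> 'y::{real_inner, polish_space}"
    and Q :: "'y \<Rightarrow> 'y" and N_Q :: "'y measure" and y :: 'y
    and C :: "'x \<Rightarrow> 'x" and \<mu>0 \<mu>y :: "'x measure" and Z :: real
  assumes "nondegenerate_centered_gaussian N_Q Q"
    and "condition_A Q F \<or> condition_B Q F"
    and "nondegenerate_centered_gaussian \<mu>0 C"
    and "prob_space \<mu>y"
    and "Z > 0"
    and "\<mu>y = density \<mu>0 (\<lambda>u. ennreal (1 / Z * exp (- potential Q F u y)))"
  shows "{x. strong_mode \<mu>y x} =
         {x. is_arg_min (functional_I C Q F y) (\<lambda>u. u \<in> range (op_sqrt C)) x}"
proof -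
  interpret Q: gaussian N_Q Q
    using assms(1) by unfold_locales
  have A: "condition_A Q F"
    using assms(2) condition_B_imp_condition_A by blast
  define G where "G = inv Q \<circ> F"
  have QG: "Q (G u) = F u" for u
  proof -
    have "F u \<in> range Q"
      using A unfolding condition_A_def by blast
    then show ?thesis
      by (simp add: G_def f_inv_into_f)
  qed
  define \<Phi> where "\<Phi> u = potential Q F u y" for u
  \<comment> \<open>F u = Q (G u) is the square root of Q applied twice to G u, and injectivity
    cancels one factor. The quadratic part of the potential thus becomes half of <Q (G u), G
    u>.\<close>
  have "inv (op_sqrt Q) (F u) = op_sqrt Q (G u)" for u
  proof -
    have "op_sqrt Q (op_sqrt Q (G u)) = F u"
      by (rule trans[OF Q.op_sqrt_C(2) QG])
    then show ?thesis
      using inv_f_f[OF Q.op_sqrt_C(3), of "op_sqrt Q (G u)"] by metis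
  qed
  then have norm_sqrt: "(norm (inv (op_sqrt Q) (F u)))\<^sup>2 = inner (Q (G u)) (G u)" for u
    unfolding power2_norm_eq_inner
    by (simp only: positive_operatorD(2)[OF Q.op_sqrt_C(1)] Q.op_sqrt_C(2) Q.C_sym)
  have \<Phi>: "\<Phi> = (\<lambda>u. inner (Q (G u)) (G u) / 2 - inner (G u) y)"
    unfolding \<Phi>_def potential_def norm_sqrt by (simp add: G_def)
  obtain L0 where L0: "L0 > 0" "\<And>u. norm (G u - G 0) \<le> L0 * norm u"
    using A unfolding condition_A_def G_def by auto
  have G_lipschitz: "\<forall>r>0. \<exists>L>0. L-lipschitz_on (ball 0 r) G"
    using A unfolding condition_A_def lipschitz_on_bounded_sets_def G_def by (elim conjE)
  have growth: "norm (G u) \<le> norm (G 0) + L0 * norm u" for u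
    using L0(2)[of u] norm_triangle_ineq2[of "G u" "G 0"] by simp
  \<comment> \<open>The quadratic part is nonnegative, so only <G u, y> can be harmful, and it is at
    most (|G 0| + L0 |u|) |y|.\<close>
  define K where "K = (norm (G 0) + L0) * norm y"
  have tilt: "gaussian_tilt \<mu>0 C \<Phi> Z K"
  proof (intro gaussian_tilt.intro gaussian.intro gaussian_tilt_axioms.intro)
    show "nondegenerate_centered_gaussian \<mu>0 C" "Z > 0"
      by fact+
    show "K \<ge> 0"
      using L0 by (simp add: K_def)
    show "prob_space (density \<mu>0 (\<lambda>u. ennreal (1 / Z * exp (- \<Phi> u))))"
      using assms(4,6) by (simp add: \<Phi>_def)
    show "\<exists>L. L-lipschitz_on (ball 0 r) \<Phi>" if "r > 0" for r
    proof -
      obtain L where "L-lipschitz_on (ball 0 r) G"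
        using G_lipschitz \<open>r > 0\<close> by blast
      moreover have "norm (G u) \<le> norm (G 0) + L0 * r" if "u \<in> ball 0 r" for u
      proof -
        have "L0 * norm u \<le> L0 * r"
          using that L0(1) by (intro mult_left_mono) auto
        then show ?thesis
          using growth[of u] by linarith
      qed
      ultimately show ?thesis
        unfolding \<Phi> by (rule lipschitz_on_quadratic_form[OF Q.positive_C])
    qed
    show "- K * (1 + norm u) \<le> \<Phi> u" for u
    proof -
      have "inner (G u) y \<le> norm (G u) * norm y"
        by (rule norm_cauchy_schwarz)
      also have "\<dots> \<le> (norm (G 0) + L0 * norm u) * norm y"
        by (intro mult_right_mono growth) simp
      also have "\<dots> \<le> ((norm (G 0) + L0) * (1 + norm u)) * norm y"
        using L0(1) by (intro mult_right_mono) (simp_all add: algebra_simps)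
      finally have "inner (G u) y \<le> K * (1 + norm u)"
        by (simp add: K_def mult_ac)
      moreover have "0 \<le> inner (Q (G u)) (G u)"
        by (rule positive_operatorD[OF Q.positive_C])
      ultimately show ?thesis
        unfolding \<Phi> by simp
    qed
  qed
  have "functional_I C Q F y = (\<lambda>u. \<Phi> u + (norm (inv (op_sqrt C) u))\<^sup>2 / 2)"
    by (simp add: fun_eq_iff functional_I_def potential_def \<Phi>_def)
  moreover have "\<mu>y = gaussian_tilt.\<nu> \<mu>0 \<Phi> Z"
    unfolding gaussian_tilt.\<nu>_def[OF tilt] assms(6) by (simp add: \<Phi>_def)
  ultimately show ?thesis
    using gaussian_tilt.strong_mode_iff_arg_min[OF tilt] by simp
qed

end
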